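(* Let $T>1$, $\Lambda_1=[-1,1]$, $f\in L^2(\Lambda_1)$, let $h_s,h_r:[0,\infty)\to(0,\infty)$ be non-decreasing functions tending to $\infty$ at infinity, and let $\mathcal F$, $\mathcal B_h$, $\mathcal R=\mathcal B_{h_r}$, $\mathcal G=\mathcal F\mathcal R^{-1}$ with singular values $(\sigma_i)$, the weighted best-approximation solution $c_{\mathcal B}^{\dag}$, and the operators $\mathcal T_k$ be as defined in the context. Suppose that $\|\mathcal B_{h_s}c_{\mathcal B}^{\dag}\|_{\ell^2}\le E$ for some constant $E>0$, and that there is a constant $C_0$ such that $$\sup_{\ell\in\mathbb Z}\frac{h_r(|\ell|)}{h_s(|\ell|)}\le C_0 .$$ For $\epsilon\in(0,\sigma_1)$ let $f^\epsilon\in L^2(\Lambda_1)$ satisfy $|f^\epsilon(x)-f(x)|\le\epsilon$ for all $x\in\Lambda_1$, let $\eta=\eta(\epsilon)=\sup\{k\mid \sigma_k>\epsilon\}$, and let $c^{\epsilon,\eta}=\mathcal R^{-1}\mathcal T_\eta f^\epsilon$. Then, as $\epsilon\to0$, $$\|\mathcal F c^{\epsilon,\eta}-f\|_{L^2(\Lambda_1)}=O(\epsilon)\qquad\text{and}\qquad \|\mathcal R(c^{\epsilon,\eta}-c_{\mathcal B}^{\dag})\|_{\ell^2}=O(1).$$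
   Context: Fix $T>1$ and $\Lambda_1=[-1,1]$. Put $\phi_0(x)=\frac1{\sqrt2}$ and $\phi_\ell(x)=e^{\mathrm i\frac{\pi}{T}\ell x}$ for $\ell=\pm1,\pm2,\dots$, $x\in\Lambda_1$. $\ell^2=\ell^2(\mathbb Z)$ (complex sequences $c=\{\hat c_\ell\}_{\ell\in\mathbb Z}$). The operator $\mathcal F:\ell^2\to L^2(\Lambda_1)$ is $\mathcal F c=\sum_{\ell\in\mathbb Z}\hat c_\ell\phi_\ell$. For a non-decreasing $h:[0,\infty)\to(0,\infty)$ with $\lim_{x\to\infty}h(x)=\infty$, $\mathcal B_h:\mathcal D(\mathcal B_h)\subset\ell^2\to\ell^2$ is the diagonal operator $c\mapsto\{h(|\ell|)\hat c_\ell\}_{\ell\in\mathbb Z}$ with its maximal domain. A least-squares solution of $\mathcal F c=f$ is a $c^\star\in\ell^2$ with $\|\mathcal F c^\star-f\|_{L^2(\Lambda_1)}=\inf_{c\in\ell^2}\|\mathcal F c-f\|_{L^2(\Lambda_1)}$. The weighted best-approximation solution $c_{\mathcal B}^{\dag}$ is the least-squares solution in $\mathcal D(\mathcal B_{h_s})$ that minimizes $\|\mathcal B_{h_s}c^\star\|_{\ell^2}$ among all least-squares solutions $c^\star$ (in $\mathcal D(\mathcal B_{h_s})$); the hypothesis $\|\mathcal B_{h_s}c_{\mathcal B}^{\dag}\|_{\ell^2}\le E$ includes that such least-squares solutions exist. $\mathcal R=\mathcal B_{h_r}$ and $\mathcal G=\mathcal F\mathcal R^{-1}:\ell^2\to L^2(\Lambda_1)$,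 which is compact. $(\sigma_i,v_i,u_i)_{i\ge1}$ is a singular system of $\mathcal G$ with $\sigma_1\ge\sigma_2\ge\cdots>0$: $\{v_i\}\subset\ell^2$ and $\{u_i\}\subset L^2(\Lambda_1)$ are orthonormal systems with $\mathcal G v_i=\sigma_iu_i$, $\mathcal G^*u_i=\sigma_iv_i$, and $\mathcal G x=\sum_i\sigma_i\langle x,v_i\rangle u_i$. For $k\ge1$, $\mathcal T_k:L^2(\Lambda_1)\to\ell^2$ is $\mathcal T_kg=\sum_{i=1}^k\frac1{\sigma_i}\langle g,u_i\rangle v_i$. The implied constants in $O(\cdot)$ are independent of $\epsilon$ and of the choice of $f^\epsilon$. *)

theory Defs
  imports "HOL-Analysis.Analysis"
begin

subsection \<open>Sequence space\<close>

definition ell2 :: "(int \<Rightarrow> complex) set" where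
  "ell2 = {c. (\<lambda>l. (cmod (c l))\<^sup>2) summable_on UNIV}"

definition ell2_inner :: "(int \<Rightarrow> complex) \<Rightarrow> (int \<Rightarrow> complex) \<Rightarrow> complex" where
  "ell2_inner c d = (\<Sum>\<^sub>\<infinity>l\<in>UNIV. c l * cnj (d l))"

definition ell2_norm :: "(int \<Rightarrow> complex) \<Rightarrow> real" where
  "ell2_norm c = sqrt (\<Sum>\<^sub>\<infinity>l\<in>UNIV. (cmod (c l))\<^sup>2)"

subsection \<open>Square-integrable functions on the interval from -1 to 1\<close>

text \<open>
  Elements of the Lebesgue space are represented by functions on the reals; only the values on
  the interval matter, and equality in the Lebesgue space is equality almost everywhere there.
\<close>

abbreviation Lam1 :: "real measure" where
  "Lam1 \<equiv> lebesgue_on {-1..1}"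

definition L2 :: "(real \<Rightarrow> complex) set" where
  "L2 = {g. g \<in> borel_measurable Lam1 \<and> integrable Lam1 (\<lambda>x. (cmod (g x))\<^sup>2)}"

definition L2_inner :: "(real \<Rightarrow> complex) \<Rightarrow> (real \<Rightarrow> complex) \<Rightarrow> complex" where
  "L2_inner g k = (LINT x|Lam1. g x * cnj (k x))"

definition L2_norm :: "(real \<Rightarrow> complex) \<Rightarrow> real" where
  "L2_norm g = sqrt (LINT x|Lam1. (cmod (g x))\<^sup>2)"

subsection \<open>Fourier extension operator\<close>

definition phi :: "real \<Rightarrow> int \<Rightarrow> real \<Rightarrow> complex" where
  "phi T l x = (if l = 0 then complex_of_real (1 / sqrt 2)
                else exp (\<i> * complex_of_real (pi / T * of_int l * x)))"

text \<open>
  The series converges unconditionally in the norm of \<open>L2\<close>. Its limit is determined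
  almost everywhere, and \<open>fourier_op\<close> picks a representative of it.
\<close>

definition fourier_op :: "real \<Rightarrow> (int \<Rightarrow> complex) \<Rightarrow> (real \<Rightarrow> complex)" where
  "fourier_op T c = (SOME g. g \<in> L2 \<and>
     ((\<lambda>A. L2_norm (\<lambda>x. (\<Sum>l\<in>A. c l * phi T l x) - g x)) \<longlongrightarrow> 0)
       (finite_subsets_at_top UNIV))"

subsection \<open>Diagonal weight operators\<close>

definition admissible_weight :: "(real \<Rightarrow> real) \<Rightarrow> bool" where
  "admissible_weight h \<longleftrightarrow>
     (\<forall>x\<ge>0. 0 < h x) \<and> mono_on {0..} h \<and> filterlim h at_top at_top"

definition weight_op :: "(real \<Rightarrow> real) \<Rightarrow> (int \<Rightarrow> complex) \<Rightarrow> (int \<Rightarrow> complex)" where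
  "weight_op h c = (\<lambda>l. complex_of_real (h (of_int \<bar>l\<bar>)) * c l)"

definition weight_dom :: "(real \<Rightarrow> real) \<Rightarrow> (int \<Rightarrow> complex) set" where
  "weight_dom h = {c \<in> ell2. weight_op h c \<in> ell2}"

definition weight_inv :: "(real \<Rightarrow> real) \<Rightarrow> (int \<Rightarrow> complex) \<Rightarrow> (int \<Rightarrow> complex)" where
  "weight_inv h = inv_into (weight_dom h) (weight_op h)"

definition G_op :: "real \<Rightarrow> (real \<Rightarrow> real) \<Rightarrow> (int \<Rightarrow> complex) \<Rightarrow> (real \<Rightarrow> complex)" where
  "G_op T h c = fourier_op T (weight_inv h c)"

subsection \<open>Least-squares solutions\<close>

definition least_squares_sol :: "real \<Rightarrow> (real \<Rightarrow> complex) \<Rightarrow> (int \<Rightarrow> complex) \<Rightarrow> bool" where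
  "least_squares_sol T f c \<longleftrightarrow> c \<in> ell2 \<and>
     L2_norm (\<lambda>x. fourier_op T c x - f x) =
       (INF d\<in>ell2. L2_norm (\<lambda>x. fourier_op T d x - f x))"

definition weighted_best_approx_sol ::
    "real \<Rightarrow> (real \<Rightarrow> real) \<Rightarrow> (real \<Rightarrow> complex) \<Rightarrow> (int \<Rightarrow> complex) \<Rightarrow> bool" where
  "weighted_best_approx_sol T h f c \<longleftrightarrow>
     least_squares_sol T f c \<and> c \<in> weight_dom h \<and>
     (\<forall>d. least_squares_sol T f d \<and> d \<in> weight_dom h \<longrightarrow>
        ell2_norm (weight_op h c) \<le> ell2_norm (weight_op h d))"

subsection \<open>Singular systems and spectral truncation\<close>

definition adjoint_op ::
    "((int \<Rightarrow> complex) \<Rightarrow> (real \<Rightarrow> complex)) \<Rightarrow> (real \<Rightarrow> complex) \<Rightarrow> (int \<Rightarrow> complex)" where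
  "adjoint_op K g = (THE d. d \<in> ell2 \<and> (\<forall>c\<in>ell2. L2_inner (K c) g = ell2_inner c d))"

text \<open>Singular systems are indexed from 1; the values at index 0 are irrelevant.\<close>

definition singular_system ::
    "((int \<Rightarrow> complex) \<Rightarrow> (real \<Rightarrow> complex)) \<Rightarrow> (nat \<Rightarrow> real) \<Rightarrow>
     (nat \<Rightarrow> int \<Rightarrow> complex) \<Rightarrow> (nat \<Rightarrow> real \<Rightarrow> complex) \<Rightarrow> bool" where
  "singular_system K \<sigma> v u \<longleftrightarrow>
     (\<forall>i\<ge>1. 0 < \<sigma> i) \<and>
     (\<forall>i\<ge>1. \<forall>j\<ge>i. \<sigma> j \<le> \<sigma> i) \<and>
     (\<forall>i\<ge>1. v i \<in> ell2) \<and>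
     (\<forall>i\<ge>1. u i \<in> L2) \<and>
     (\<forall>i\<ge>1. \<forall>j\<ge>1. ell2_inner (v i) (v j) = (if i = j then 1 else 0)) \<and>
     (\<forall>i\<ge>1. \<forall>j\<ge>1. L2_inner (u i) (u j) = (if i = j then 1 else 0)) \<and>
     (\<forall>i\<ge>1. AE x in Lam1. K (v i) x = complex_of_real (\<sigma> i) * u i x) \<and>
     (\<forall>i\<ge>1. adjoint_op K (u i) = (\<lambda>l. complex_of_real (\<sigma> i) * v i l)) \<and>
     (\<forall>c\<in>ell2. (\<lambda>n. L2_norm (\<lambda>x. (\<Sum>i=1..n. complex_of_real (\<sigma> i) * ell2_inner c (v i) * u i x)
                              - K c x)) \<longlonglongrightarrow> 0)"

definition trunc_op ::
    "(nat \<Rightarrow> real) \<Rightarrow> (nat \<Rightarrow> int \<Rightarrow> complex) \<Rightarrow> (nat \<Rightarrow> real \<Rightarrow> complex) \<Rightarrow> nat \<Rightarrow>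
     (real \<Rightarrow> complex) \<Rightarrow> (int \<Rightarrow> complex)" where
  "trunc_op \<sigma> v u k g =
     (\<lambda>l. \<Sum>i=1..k. complex_of_real (1 / \<sigma> i) * L2_inner g (u i) * v i l)"

text \<open>
  For the compact operators considered here the singular values tend to 0, so for
  \<open>0 < \<epsilon> < \<sigma> 1\<close> the set below is finite and nonempty and the supremum on
  the naturals is its maximum.
\<close>

definition trunc_index :: "(nat \<Rightarrow> real) \<Rightarrow> real \<Rightarrow> nat" where
  "trunc_index \<sigma> \<epsilon> = Sup {k. 1 \<le> k \<and> \<epsilon> < \<sigma> k}"

definition regularized_sol ::
    "(real \<Rightarrow> real) \<Rightarrow> (nat \<Rightarrow> real) \<Rightarrow> (nat \<Rightarrow> int \<Rightarrow> complex) \<Rightarrow>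
     (nat \<Rightarrow> real \<Rightarrow> complex) \<Rightarrow> real \<Rightarrow> (real \<Rightarrow> complex) \<Rightarrow> (int \<Rightarrow> complex)" where
  "regularized_sol h \<sigma> v u \<epsilon> g = weight_inv h (trunc_op \<sigma> v u (trunc_index \<sigma> \<epsilon>) g)"

end

theory Submission imports Defs begin

text \<open>
  Exponentials of period \<open>2 * T > 2\<close> are orthogonal on \<open>{-T..T}\<close>, so the Fourier extension operator
  is bounded, and they are total on \<open>{-1..1}\<close> by Stone--Weierstrass. Hence the least-squares residual
  vanishes and \<open>f = G x\<close> with \<open>x = weight_op h\<^sub>r cdag\<close>, whose norm is at most \<open>C\<^sub>0 * E\<close>. Expanding in
  the singular system, the coefficient error is the difference of \<open>T\<^sub>k (g - f)\<close>, of norm at most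
  \<open>\<parallel>g - f\<parallel> / \<epsilon>\<close>, and the tail of \<open>x\<close> beyond \<open>k\<close>; applying \<open>G\<close> turns these two terms into a
  projection of \<open>g - f\<close> and a tail damped by singular values at most \<open>\<epsilon>\<close>.
\<close>

subsection \<open>Square-integrable functions\<close>

text \<open>Both terms of the coefficient error remain of order 1: noise of size \<epsilon> is
  divided by singular values above \<epsilon>, and the tail of \<open>x\<close> has no rate. It
  cannot be expected to vanish, since functions on a period that live outside the interval give the
  operator a large kernel, so the \<open>v i\<close> need not span the sequence space. Two features
  of the definitions shape the argument. \<open>fourier_op\<close> picks some representative of the
  limit, hence it is linear only almost everywhere and comparisons go through the seminorm
  \<open>sq_norm\<close>. And \<open>trunc_index\<close> is a supremum of naturals, which has the
  intended meaning only if finitely many singular values exceed \<epsilon>;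
  \<open>singular_system\<close> does not state this decay, so it is derived from the growth of the
  weight. The measure is a parameter so that the counting measure, the interval and a full period
  share one theory.\<close>

definition sq_integrable :: "'a measure \<Rightarrow> ('a \<Rightarrow> complex) set" where
  "sq_integrable M = {g. g \<in> borel_measurable M \<and> integrable M (\<lambda>x. (cmod (g x))\<^sup>2)}"

definition sq_inner :: "'a measure \<Rightarrow> ('a \<Rightarrow> complex) \<Rightarrow> ('a \<Rightarrow> complex) \<Rightarrow> complex" where
  "sq_inner M g k = (LINT x|M. g x * cnj (k x))"

definition sq_norm :: "'a measure \<Rightarrow> ('a \<Rightarrow> complex) \<Rightarrow> real" where
  "sq_norm M g = sqrt (LINT x|M. (cmod (g x))\<^sup>2)"

lemma borel_measurable_cnj [measurable]:
  "g \<in> borel_measurable M \<Longrightarrow> (\<lambda>x. cnj (g x)) \<in> borel_measurable M"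
  by (rule borel_measurable_continuous_on[where f = cnj]) (intro continuous_intros)

lemma sq_integrable_measurable: "g \<in> sq_integrable M \<Longrightarrow> g \<in> borel_measurable M"
  by (simp add: sq_integrable_def)

lemma sq_integrable_integrable: "g \<in> sq_integrable M \<Longrightarrow> integrable M (\<lambda>x. (cmod (g x))\<^sup>2)"
  by (simp add: sq_integrable_def)

lemma integrable_cmod_mult:
  assumes "g \<in> sq_integrable M" "k \<in> sq_integrable M"
  shows "integrable M (\<lambda>x. cmod (g x) * cmod (k x))"
proof (rule Bochner_Integration.integrable_bound)
  show "integrable M (\<lambda>x. (cmod (g x))\<^sup>2 + (cmod (k x))\<^sup>2)"
    using assms by (simp add: sq_integrable_integrable)
  show "(\<lambda>x. cmod (g x) * cmod (k x)) \<in> borel_measurable M"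
    using assms[THEN sq_integrable_measurable] by measurable
  show "AE x in M. norm (cmod (g x) * cmod (k x)) \<le> norm ((cmod (g x))\<^sup>2 + (cmod (k x))\<^sup>2)"
  proof (rule AE_I2)
    fix x
    have "2 * (cmod (g x) * cmod (k x)) \<le> (cmod (g x))\<^sup>2 + (cmod (k x))\<^sup>2"
      using sum_squares_bound[of "cmod (g x)" "cmod (k x)"] by (simp add: mult.assoc)
    moreover have "0 \<le> cmod (g x) * cmod (k x)" by simp
    ultimately show "norm (cmod (g x) * cmod (k x)) \<le> norm ((cmod (g x))\<^sup>2 + (cmod (k x))\<^sup>2)"
      unfolding real_norm_def by linarith
  qed
qed

lemma integrable_mult_cnj:
  assumes "g \<in> sq_integrable M" "k \<in> sq_integrable M"
  shows "integrable M (\<lambda>x. g x * cnj (k x))"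
proof (rule Bochner_Integration.integrable_bound[OF integrable_cmod_mult[OF assms]])
  show "(\<lambda>x. g x * cnj (k x)) \<in> borel_measurable M"
    using assms[THEN sq_integrable_measurable] by measurable
qed (simp add: norm_mult)

lemma sq_integrable_add:
  assumes "g \<in> sq_integrable M" "k \<in> sq_integrable M"
  shows "(\<lambda>x. g x + k x) \<in> sq_integrable M"
proof -
  have m: "(\<lambda>x. g x + k x) \<in> borel_measurable M"
    using assms[THEN sq_integrable_measurable] by measurable
  have "integrable M (\<lambda>x. (cmod (g x + k x))\<^sup>2)"
  proof (rule Bochner_Integration.integrable_bound)
    show "integrable M (\<lambda>x. 2 * (cmod (g x))\<^sup>2 + 2 * (cmod (k x))\<^sup>2)"
      using assms by (simp add: sq_integrable_integrable)
    show "(\<lambda>x. (cmod (g x + k x))\<^sup>2) \<in> borel_measurable M" using m by measurable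
    show "AE x in M. norm ((cmod (g x + k x))\<^sup>2) \<le> norm (2 * (cmod (g x))\<^sup>2 + 2 * (cmod (k x))\<^sup>2)"
    proof (rule AE_I2)
      fix x
      have "(cmod (g x + k x))\<^sup>2 \<le> (cmod (g x) + cmod (k x))\<^sup>2"
        by (intro power_mono norm_triangle_ineq) auto
      also have "\<dots> \<le> 2 * (cmod (g x))\<^sup>2 + 2 * (cmod (k x))\<^sup>2"
        using sum_squares_bound[of "cmod (g x)" "cmod (k x)"] by (simp add: power2_sum)
      finally show "norm ((cmod (g x + k x))\<^sup>2) \<le> norm (2 * (cmod (g x))\<^sup>2 + 2 * (cmod (k x))\<^sup>2)"
        by simp
    qed
  qed
  with m show ?thesis by (simp add: sq_integrable_def)
qed

lemma sq_integrable_scale: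
  assumes "g \<in> sq_integrable M"
  shows "(\<lambda>x. a * g x) \<in> sq_integrable M"
  using assms by (auto simp: sq_integrable_def norm_mult power_mult_distrib intro: borel_measurable_times)

lemma sq_integrable_diff:
  assumes "g \<in> sq_integrable M" "k \<in> sq_integrable M"
  shows "(\<lambda>x. g x - k x) \<in> sq_integrable M"
  using sq_integrable_add[OF assms(1) sq_integrable_scale[OF assms(2), of "-1"]] by simp

lemma sq_integrable_zero: "(\<lambda>x. 0) \<in> sq_integrable M"
  by (simp add: sq_integrable_def)

lemma sq_integrable_sum:
  assumes "\<And>i. i \<in> A \<Longrightarrow> w i \<in> sq_integrable M"
  shows "(\<lambda>x. \<Sum>i\<in>A. c i * w i x) \<in> sq_integrable M"
  using assms
  by (induction A rule: infinite_finite_induct)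
     (auto intro!: sq_integrable_add sq_integrable_scale sq_integrable_zero)

lemma sq_norm_nonneg: "0 \<le> sq_norm M g"
  by (simp add: sq_norm_def)

lemma sq_norm_power2: "(sq_norm M g)\<^sup>2 = (LINT x|M. (cmod (g x))\<^sup>2)"
  by (simp add: sq_norm_def)

lemma sq_inner_self: "sq_inner M g g = of_real ((sq_norm M g)\<^sup>2)"
proof -
  have "sq_inner M g g = (LINT x|M. of_real ((cmod (g x))\<^sup>2))"
    unfolding sq_inner_def by (simp only: complex_norm_square)
  also have "\<dots> = of_real (LINT x|M. (cmod (g x))\<^sup>2)"
    by (rule integral_complex_of_real)
  finally show ?thesis by (simp add: sq_norm_power2)
qed

lemma sq_inner_commute: "sq_inner M k g = cnj (sq_inner M g k)"
  unfolding sq_inner_def by (subst Bochner_Integration.integral_cnj[symmetric])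
    (simp only: complex_cnj_mult complex_cnj_cnj mult.commute)

lemma sq_inner_diff_left:
  assumes "f \<in> sq_integrable M" "g \<in> sq_integrable M" "k \<in> sq_integrable M"
  shows "sq_inner M (\<lambda>x. f x - g x) k = sq_inner M f k - sq_inner M g k"
  using assms unfolding sq_inner_def by (simp add: left_diff_distrib integrable_mult_cnj)

lemma sq_inner_scale_left: "sq_inner M (\<lambda>x. a * g x) k = a * sq_inner M g k"
  unfolding sq_inner_def by (simp add: mult.assoc)

lemma sq_inner_sum_left:
  assumes "\<And>i. i \<in> A \<Longrightarrow> w i \<in> sq_integrable M" "k \<in> sq_integrable M"
  shows "sq_inner M (\<lambda>x. \<Sum>i\<in>A. c i * w i x) k = (\<Sum>i\<in>A. c i * sq_inner M (w i) k)"
proof -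
  have "sq_inner M (\<lambda>x. \<Sum>i\<in>A. c i * w i x) k = (LINT x|M. (\<Sum>i\<in>A. c i * (w i x * cnj (k x))))"
    unfolding sq_inner_def by (simp add: sum_distrib_right mult.assoc)
  also have "\<dots> = (\<Sum>i\<in>A. LINT x|M. c i * (w i x * cnj (k x)))"
    using assms by (intro Bochner_Integration.integral_sum integrable_mult_right integrable_mult_cnj)
  finally show ?thesis by (simp add: sq_inner_def)
qed

lemma sq_inner_scale_right: "sq_inner M g (\<lambda>x. a * k x) = cnj a * sq_inner M g k"
  by (subst (1 2) sq_inner_commute) (simp add: sq_inner_scale_left)

lemma sq_inner_sum_right:
  assumes "\<And>i. i \<in> A \<Longrightarrow> w i \<in> sq_integrable M" "k \<in> sq_integrable M"
  shows "sq_inner M k (\<lambda>x. \<Sum>i\<in>A. c i * w i x) = (\<Sum>i\<in>A. cnj (c i) * sq_inner M k (w i))"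
  by (subst (1 2) sq_inner_commute) (simp add: sq_inner_sum_left assms cnj_sum)

lemma sq_norm_add_power2:
  assumes "g \<in> sq_integrable M" "k \<in> sq_integrable M"
  shows "(sq_norm M (\<lambda>x. g x + k x))\<^sup>2 = (sq_norm M g)\<^sup>2 + 2 * Re (sq_inner M g k) + (sq_norm M k)\<^sup>2"
proof -
  have "(sq_norm M (\<lambda>x. g x + k x))\<^sup>2
      = (LINT x|M. (cmod (g x))\<^sup>2 + 2 * Re (g x * cnj (k x)) + (cmod (k x))\<^sup>2)"
    unfolding sq_norm_power2 by (simp add: cmod_power2 power2_sum algebra_simps)
  also have "\<dots> = (LINT x|M. (cmod (g x))\<^sup>2) + 2 * (LINT x|M. Re (g x * cnj (k x)))
      + (LINT x|M. (cmod (k x))\<^sup>2)"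
    using sq_integrable_integrable[OF assms(1)] sq_integrable_integrable[OF assms(2)]
      integrable_Re[OF integrable_mult_cnj[OF assms]]
    by (simp only: Bochner_Integration.integral_add Bochner_Integration.integrable_add
        Bochner_Integration.integrable_mult_right Bochner_Integration.integral_mult_right_zero)
  also have "(LINT x|M. Re (g x * cnj (k x))) = Re (sq_inner M g k)"
    unfolding sq_inner_def by (rule integral_Re[OF integrable_mult_cnj[OF assms]])
  finally show ?thesis by (simp add: sq_norm_power2)
qed

lemma sq_norm_scale: "sq_norm M (\<lambda>x. a * g x) = cmod a * sq_norm M g"
  unfolding sq_norm_def by (simp add: norm_mult power_mult_distrib real_sqrt_mult)

lemma sq_norm_diff_power2:
  assumes "g \<in> sq_integrable M" "k \<in> sq_integrable M"
  shows "(sq_norm M (\<lambda>x. g x - k x))\<^sup>2 = (sq_norm M g)\<^sup>2 - 2 * Re (sq_inner M g k) + (sq_norm M k)\<^sup>2"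
  using sq_norm_add_power2[OF assms(1) sq_integrable_scale[OF assms(2), of "-1"]]
  by (simp add: sq_norm_scale[of M "-1" k, simplified] sq_inner_scale_right[of M g "-1" k, simplified])

text \<open>The square of \<open>t * cmod (g x) - cmod (k x)\<close> has nonnegative integral for
  every real \<open>t\<close>; a good \<open>t\<close> gives the claim. The moduli stand inside the
  integral because with \<open>k = 1\<close> this bounds the L1 norm by the L2 norm.\<close>

lemma sq_Cauchy_Schwarz:
  assumes g: "g \<in> sq_integrable M" and k: "k \<in> sq_integrable M"
  shows "(LINT x|M. cmod (g x) * cmod (k x)) \<le> sq_norm M g * sq_norm M k"
proof -
  define a b A where "a = (LINT x|M. (cmod (g x))\<^sup>2)" and "b = (LINT x|M. (cmod (k x))\<^sup>2)"
    and "A = (LINT x|M. cmod (g x) * cmod (k x))"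
  have A0: "0 \<le> A" unfolding A_def by simp
  have a0: "0 \<le> a" unfolding a_def by simp
  have q: "2 * t * A \<le> t\<^sup>2 * a + b" for t
  proof -
    have "0 \<le> (LINT x|M. (t * cmod (g x) - cmod (k x))\<^sup>2)" by simp
    also have "\<dots> = (LINT x|M. t\<^sup>2 * (cmod (g x))\<^sup>2 + (cmod (k x))\<^sup>2 - 2 * t * (cmod (g x) * cmod (k x)))"
      by (simp add: power2_diff power_mult_distrib mult.assoc)
    also have "\<dots> = t\<^sup>2 * a + b - 2 * t * A"
      using sq_integrable_integrable[OF g] sq_integrable_integrable[OF k] integrable_cmod_mult[OF g k]
      by (simp add: a_def b_def A_def)
    finally show ?thesis by simp
  qed
  have "A\<^sup>2 \<le> a * b"
  proof (cases "a = 0")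
    case True
    have "A = 0"
    proof (rule ccontr)
      assume "A \<noteq> 0"
      \<comment> \<open>With \<open>a = 0\<close> the bound \<open>q\<close> is linear in
        \<open>t\<close>; this \<open>t\<close> would give \<open>b + 1 \<le> b\<close>.\<close>
      with q[of "(b + 1) / (2 * A)"] True show False by simp
    qed
    with True show ?thesis by simp
  next
    case False
    with a0 have "a > 0" by simp
    \<comment> \<open>\<open>A / a\<close> minimises the quadratic in \<open>t\<close>.\<close>
    with q[of "A / a"] show ?thesis
      by (simp add: field_simps power2_eq_square)
  qed
  then have "A \<le> sqrt (a * b)" by (rule real_le_rsqrt)
  then show ?thesis by (simp add: sq_norm_def real_sqrt_mult A_def a_def b_def)
qed

lemma sq_inner_bound:
  assumes "g \<in> sq_integrable M" "k \<in> sq_integrable M"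
  shows "cmod (sq_inner M g k) \<le> sq_norm M g * sq_norm M k"
proof -
  have "cmod (sq_inner M g k) \<le> (LINT x|M. cmod (g x * cnj (k x)))"
    unfolding sq_inner_def by (rule integral_norm_bound)
  then show ?thesis using sq_Cauchy_Schwarz[OF assms] by (simp add: norm_mult)
qed

lemma sq_norm_triangle:
  assumes "g \<in> sq_integrable M" "k \<in> sq_integrable M"
  shows "sq_norm M (\<lambda>x. g x + k x) \<le> sq_norm M g + sq_norm M k"
proof (rule power2_le_imp_le)
  have "Re (sq_inner M g k) \<le> sq_norm M g * sq_norm M k"
    using complex_Re_le_cmod sq_inner_bound[OF assms] by (rule order_trans)
  then show "(sq_norm M (\<lambda>x. g x + k x))\<^sup>2 \<le> (sq_norm M g + sq_norm M k)\<^sup>2"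
    by (simp add: sq_norm_add_power2[OF assms] power2_sum)
qed (simp add: sq_norm_nonneg)

lemma sq_norm_minus_commute: "sq_norm M (\<lambda>x. g x - k x) = sq_norm M (\<lambda>x. k x - g x)"
  unfolding sq_norm_def by (simp add: norm_minus_commute)

lemma sq_norm_triangle_diff:
  assumes "f \<in> sq_integrable M" "g \<in> sq_integrable M" "k \<in> sq_integrable M"
  shows "sq_norm M (\<lambda>x. f x - k x) \<le> sq_norm M (\<lambda>x. f x - g x) + sq_norm M (\<lambda>x. g x - k x)"
  using sq_norm_triangle[OF sq_integrable_diff[OF assms(1,2)] sq_integrable_diff[OF assms(2,3)]]
  by simp

lemma sq_norm_cong_AE:
  assumes "AE x in M. g x = k x" "g \<in> borel_measurable M" "k \<in> borel_measurable M"
  shows "sq_norm M g = sq_norm M k"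
proof -
  have "(LINT x|M. (cmod (g x))\<^sup>2) = (LINT x|M. (cmod (k x))\<^sup>2)"
    using assms by (intro integral_cong_AE) auto
  then show ?thesis by (simp add: sq_norm_def)
qed

lemma sq_norm_eq_0_AE:
  assumes "g \<in> sq_integrable M" "sq_norm M g = 0"
  shows "AE x in M. g x = 0"
proof -
  have "(LINT x|M. (cmod (g x))\<^sup>2) = 0" using assms(2) by (simp add: sq_norm_def)
  then have "AE x in M. (cmod (g x))\<^sup>2 = 0"
    by (subst (asm) integral_nonneg_eq_0_iff_AE) (auto simp: sq_integrable_integrable assms)
  then show ?thesis by simp
qed

section \<open>Orthogonal sums, projections and Bessel's inequality\<close>

text \<open>The squared norms \<open>N\<close> are left free: they are 1 for singular vectors, but
  \<open>T\<close> or \<open>2 * T\<close> for the exponentials on a full period.\<close>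

lemma sq_norm_orthogonal_sum:
  assumes "finite A" "\<And>i. i \<in> A \<Longrightarrow> w i \<in> sq_integrable M"
    and "\<And>i j. i \<in> A \<Longrightarrow> j \<in> A \<Longrightarrow> sq_inner M (w i) (w j) = (if i = j then of_real (N i) else 0)"
  shows "(sq_norm M (\<lambda>x. \<Sum>i\<in>A. c i * w i x))\<^sup>2 = (\<Sum>i\<in>A. (cmod (c i))\<^sup>2 * N i)"
proof -
  have "complex_of_real ((sq_norm M (\<lambda>x. \<Sum>i\<in>A. c i * w i x))\<^sup>2)
      = (\<Sum>i\<in>A. c i * (\<Sum>j\<in>A. cnj (c j) * sq_inner M (w i) (w j)))"
    unfolding sq_inner_self[symmetric]
    by (simp add: sq_inner_sum_left sq_inner_sum_right sq_integrable_sum assms(2))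
  also have "\<dots> = (\<Sum>i\<in>A. c i * (\<Sum>j\<in>A. if i = j then cnj (c j) * of_real (N i) else 0))"
    by (intro sum.cong refl arg_cong2[where f = "(*)"]) (simp add: assms(3))
  also have "\<dots> = (\<Sum>i\<in>A. c i * (cnj (c i) * of_real (N i)))"
    using assms(1) by (intro sum.cong refl) (simp)
  also have "\<dots> = of_real (\<Sum>i\<in>A. (cmod (c i))\<^sup>2 * N i)"
    by (simp add: complex_norm_square mult.assoc del: of_real_power)
  finally show ?thesis by (simp only: of_real_eq_iff)
qed

text \<open>The inner product of \<open>g\<close> with its projection and the squared norm of the
  projection are the same sum, so expanding the square leaves minus one copy of it.\<close>

lemma sq_norm_diff_projection:
  assumes "finite A" "\<And>i. i \<in> A \<Longrightarrow> w i \<in> sq_integrable M" "g \<in> sq_integrable M"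
    and "\<And>i j. i \<in> A \<Longrightarrow> j \<in> A \<Longrightarrow> sq_inner M (w i) (w j) = (if i = j then 1 else 0)"
  shows "(sq_norm M (\<lambda>x. g x - (\<Sum>i\<in>A. sq_inner M g (w i) * w i x)))\<^sup>2
    = (sq_norm M g)\<^sup>2 - (\<Sum>i\<in>A. (cmod (sq_inner M g (w i)))\<^sup>2)"
proof -
  let ?p = "\<lambda>x. \<Sum>i\<in>A. sq_inner M g (w i) * w i x"
  have p: "?p \<in> sq_integrable M" using assms(2) by (rule sq_integrable_sum)
  have "sq_inner M g ?p = (\<Sum>i\<in>A. cnj (sq_inner M g (w i)) * sq_inner M g (w i))"
    using assms by (intro sq_inner_sum_right) auto
  also have "\<dots> = of_real (\<Sum>i\<in>A. (cmod (sq_inner M g (w i)))\<^sup>2)"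
    by (simp add: complex_norm_square mult.commute del: of_real_power)
  finally have "Re (sq_inner M g ?p) = (\<Sum>i\<in>A. (cmod (sq_inner M g (w i)))\<^sup>2)" by simp
  moreover have "(sq_norm M ?p)\<^sup>2 = (\<Sum>i\<in>A. (cmod (sq_inner M g (w i)))\<^sup>2 * 1)"
    using assms by (intro sq_norm_orthogonal_sum) auto
  ultimately show ?thesis
    using sq_norm_diff_power2[OF assms(3) p] by simp
qed

lemma Bessel_inequality:
  assumes "finite A" "\<And>i. i \<in> A \<Longrightarrow> w i \<in> sq_integrable M" "g \<in> sq_integrable M"
    and "\<And>i j. i \<in> A \<Longrightarrow> j \<in> A \<Longrightarrow> sq_inner M (w i) (w j) = (if i = j then 1 else 0)"
  shows "(\<Sum>i\<in>A. (cmod (sq_inner M g (w i)))\<^sup>2) \<le> (sq_norm M g)\<^sup>2"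
proof -
  have "0 \<le> (sq_norm M (\<lambda>x. g x - (\<Sum>i\<in>A. sq_inner M g (w i) * w i x)))\<^sup>2" by simp
  then show ?thesis using sq_norm_diff_projection[of A w M g] assms by simp
qed

lemma sq_norm_projection_error_le:
  assumes "finite A" "\<And>i. i \<in> A \<Longrightarrow> w i \<in> sq_integrable M" "g \<in> sq_integrable M"
    and "\<And>i j. i \<in> A \<Longrightarrow> j \<in> A \<Longrightarrow> sq_inner M (w i) (w j) = (if i = j then 1 else 0)"
  shows "sq_norm M (\<lambda>x. g x - (\<Sum>i\<in>A. sq_inner M g (w i) * w i x)) \<le> sq_norm M g"
proof (rule power2_le_imp_le)
  show "(sq_norm M (\<lambda>x. g x - (\<Sum>i\<in>A. sq_inner M g (w i) * w i x)))\<^sup>2 \<le> (sq_norm M g)\<^sup>2"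
    using sq_norm_diff_projection[of A w M g] assms by (simp add: sum_nonneg)
qed (rule sq_norm_nonneg)

section \<open>Completeness\<close>

text \<open>Only measurability of \<open>g\<close> is known beforehand; square integrability comes
  out of the bound. This turns convergence almost everywhere into a norm estimate for the
  limit.\<close>

lemma Fatou_sq_norm:
  assumes w: "\<And>n. w n \<in> sq_integrable M" and g: "g \<in> borel_measurable M"
    and lim: "AE x in M. (\<lambda>n. w n x) \<longlonglongrightarrow> g x"
    and bound: "eventually (\<lambda>n. sq_norm M (w n) \<le> B) sequentially"
  shows "g \<in> sq_integrable M \<and> sq_norm M g \<le> B"
proof -
  have [measurable]: "w n \<in> borel_measurable M" for n using w by (rule sq_integrable_measurable)
  note g[measurable]
  obtain n0 where "sq_norm M (w n0) \<le> B"
    using bound by (auto simp: eventually_sequentially)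
  then have B0: "0 \<le> B" using sq_norm_nonneg[of M "w n0"] by linarith
  have nn: "(\<integral>\<^sup>+x. ennreal ((cmod (w n x))\<^sup>2) \<partial>M) = ennreal ((sq_norm M (w n))\<^sup>2)" for n
    unfolding sq_norm_power2 by (intro nn_integral_eq_integral sq_integrable_integrable w) auto
  have "(\<integral>\<^sup>+x. ennreal ((cmod (g x))\<^sup>2) \<partial>M)
      = (\<integral>\<^sup>+x. liminf (\<lambda>n. ennreal ((cmod (w n x))\<^sup>2)) \<partial>M)"
  proof (rule nn_integral_cong_AE, use lim in eventually_elim)
    case (elim x)
    have "(\<lambda>n. ennreal ((cmod (w n x))\<^sup>2)) \<longlonglongrightarrow> ennreal ((cmod (g x))\<^sup>2)"
      using elim by (intro tendsto_ennrealI tendsto_intros)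
    then show ?case by (rule lim_imp_Liminf[OF sequentially_bot, symmetric])
  qed
  also have "\<dots> \<le> liminf (\<lambda>n. \<integral>\<^sup>+x. ennreal ((cmod (w n x))\<^sup>2) \<partial>M)"
    by (rule nn_integral_liminf) measurable
  also have "\<dots> \<le> ennreal (B\<^sup>2)"
    unfolding nn
  proof (rule Liminf_le[OF sequentially_bot])
    show "\<forall>\<^sub>F n in sequentially. ennreal ((sq_norm M (w n))\<^sup>2) \<le> ennreal (B\<^sup>2)"
      using bound by eventually_elim (intro ennreal_leI power_mono sq_norm_nonneg)
  qed
  finally have le: "(\<integral>\<^sup>+x. ennreal ((cmod (g x))\<^sup>2) \<partial>M) \<le> ennreal (B\<^sup>2)" .
  have int: "integrable M (\<lambda>x. (cmod (g x))\<^sup>2)"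
    using le by (intro integrableI_bounded) (auto intro: le_less_trans)
  have "ennreal (LINT x|M. (cmod (g x))\<^sup>2) \<le> ennreal (B\<^sup>2)"
    using le by (subst nn_integral_eq_integral[symmetric, OF int]) auto
  then have "(sq_norm M g)\<^sup>2 \<le> B\<^sup>2"
    by (simp add: sq_norm_power2)
  then have "sq_norm M g \<le> B" using B0 by (rule power2_le_imp_le)
  with int g show ?thesis by (simp add: sq_integrable_def)
qed

text \<open>On a finite measure the L2 norm controls the L1 norm, and an L1 Cauchy sequence has a
  subsequence that is Cauchy almost everywhere. Its pointwise limit is the candidate, and Fatou's
  lemma carries the Cauchy estimate over to it.\<close>

theorem Riesz_Fischer:
  assumes "finite_measure M" and s: "\<And>n. s n \<in> sq_integrable M"
    and Cauchy: "\<And>e. e > 0 \<Longrightarrow> \<exists>N. \<forall>m\<ge>N. \<forall>n\<ge>N. sq_norm M (\<lambda>x. s m x - s n x) < e"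
  shows "\<exists>g\<in>sq_integrable M. (\<lambda>n. sq_norm M (\<lambda>x. s n x - g x)) \<longlonglongrightarrow> 0"
proof -
  interpret finite_measure M by fact
  have one: "(\<lambda>x. 1) \<in> sq_integrable M" by (simp add: sq_integrable_def)
  \<comment> \<open>The summand 1 keeps \<open>K\<close> positive even for the zero measure;
    \<open>e / K\<close> is needed below.\<close>
  define K where "K = sq_norm M (\<lambda>x. 1) + 1"
  have K: "K > 0" unfolding K_def using sq_norm_nonneg[of M "\<lambda>x. 1"] by linarith
  have L1: "(LINT x|M. norm (h x)) \<le> sq_norm M h * K" if "h \<in> sq_integrable M" for h
    using sq_Cauchy_Schwarz[OF that one] sq_norm_nonneg[of M h]
    by (simp add: K_def distrib_left)
  have [measurable]: "s n \<in> borel_measurable M" for n using s by (rule sq_integrable_measurable)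
  have "integrable M (s n)" for n
    using integrable_mult_cnj[OF s one] by simp
  moreover have "\<exists>N. \<forall>i\<ge>N. \<forall>j\<ge>N. LINT x|M. norm (s i x - s j x) < e" if "e > 0" for e
  proof -
    from Cauchy[of "e / K"] that K obtain N
      where N: "\<forall>m\<ge>N. \<forall>n\<ge>N. sq_norm M (\<lambda>x. s m x - s n x) < e / K" by auto
    have "LINT x|M. norm (s i x - s j x) < e" if "i \<ge> N" "j \<ge> N" for i j
    proof -
      have "sq_norm M (\<lambda>x. s i x - s j x) * K < e"
        using N that K by (simp add: pos_less_divide_eq)
      with L1[OF sq_integrable_diff[OF s s], of i j] show ?thesis by linarith
    qed
    then show ?thesis by blast
  qed
  ultimately obtain r where r: "strict_mono r" and AE: "AE x in M. Cauchy (\<lambda>i. s (r i) x)"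
    by (rule cauchy_L1_AE_cauchy_subseq)
  define g where "g x = lim (\<lambda>i. s (r i) x)" for x
  have g[measurable]: "g \<in> borel_measurable M" unfolding g_def by measurable
  have lim: "AE x in M. (\<lambda>i. s (r i) x) \<longlonglongrightarrow> g x"
    using AE by eventually_elim (simp add: g_def Cauchy_convergent_iff convergent_LIMSEQ_iff)
  have key: "\<exists>N. \<forall>n\<ge>N. (\<lambda>x. s n x - g x) \<in> sq_integrable M \<and> sq_norm M (\<lambda>x. s n x - g x) \<le> e"
    if e: "e > 0" for e
  proof -
    from Cauchy[OF e] obtain N
      where N: "\<forall>m\<ge>N. \<forall>n\<ge>N. sq_norm M (\<lambda>x. s m x - s n x) < e" by auto
    \<comment> \<open>Here \<open>n\<close> is fixed and the other index runs to infinity along the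
      subsequence.\<close>
    have "(\<lambda>x. s n x - g x) \<in> sq_integrable M \<and> sq_norm M (\<lambda>x. s n x - g x) \<le> e" if "n \<ge> N" for n
    proof (rule Fatou_sq_norm)
      show "(\<lambda>x. s n x - s (r i) x) \<in> sq_integrable M" for i
        by (intro sq_integrable_diff s)
      show "(\<lambda>x. s n x - g x) \<in> borel_measurable M" by measurable
      show "AE x in M. (\<lambda>i. s n x - s (r i) x) \<longlonglongrightarrow> s n x - g x"
        using lim by eventually_elim (intro tendsto_intros)
      have "sq_norm M (\<lambda>x. s n x - s (r i) x) \<le> e" if "i \<ge> N" for i
        using N \<open>n \<ge> N\<close> that seq_suble[OF r, of i] by (intro less_imp_le) auto
      then show "\<forall>\<^sub>F i in sequentially. sq_norm M (\<lambda>x. s n x - s (r i) x) \<le> e"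
        by (auto simp: eventually_sequentially)
    qed
    then show ?thesis by blast
  qed
  \<comment> \<open>\<open>g\<close> is \<open>s n\<close> minus the square integrable difference
    \<open>s n - g\<close>.\<close>
  obtain n where "(\<lambda>x. s n x - g x) \<in> sq_integrable M" using key[of 1] by auto
  from sq_integrable_diff[OF s[of n] this] have "g \<in> sq_integrable M" by simp
  moreover have "(\<lambda>n. sq_norm M (\<lambda>x. s n x - g x)) \<longlonglongrightarrow> 0"
  proof (rule LIMSEQ_I)
    fix e :: real assume "e > 0"
    with key[of "e / 2"] obtain N where "\<forall>n\<ge>N. sq_norm M (\<lambda>x. s n x - g x) \<le> e / 2" by auto
    with \<open>e > 0\<close> have "\<forall>n\<ge>N. norm (sq_norm M (\<lambda>x. s n x - g x) - 0) < e"
      by (auto simp: sq_norm_nonneg intro: le_less_trans)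
    then show "\<exists>N. \<forall>n\<ge>N. norm (sq_norm M (\<lambda>x. s n x - g x) - 0) < e" by blast
  qed
  ultimately show ?thesis by blast
qed

subsection \<open>The two concrete spaces\<close>

lemma L2_eq: "L2 = sq_integrable Lam1"
  by (simp add: L2_def sq_integrable_def)

lemma L2_inner_eq: "L2_inner = sq_inner Lam1"
  by (simp add: L2_inner_def sq_inner_def fun_eq_iff)

lemma L2_norm_eq: "L2_norm = sq_norm Lam1"
  by (simp add: L2_norm_def sq_norm_def fun_eq_iff)

abbreviation ints :: "int measure" where "ints \<equiv> count_space UNIV"

text \<open>The sequence space is defined through \<open>summable_on\<close> and
  \<open>infsum\<close>; this equivalence and the next lemma translate it into integration over the
  counting measure.\<close>

lemma integrable_count_space_iff:
  fixes g :: "'a \<Rightarrow> 'b::{banach, second_countable_topology}"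
  shows "integrable (count_space UNIV) g \<longleftrightarrow> (\<lambda>x. norm (g x)) summable_on UNIV"
  using abs_summable_equivalent[of g UNIV] by (simp add: Infinite_Set_Sum.abs_summable_on_def)

lemma integral_count_space_eq_infsum:
  fixes g :: "'a \<Rightarrow> 'b::{banach, second_countable_topology}"
  assumes "integrable (count_space UNIV) g"
  shows "integral\<^sup>L (count_space UNIV) g = infsum g UNIV"
  using infsetsum_infsum[of g UNIV] assms
  by (simp add: Infinite_Set_Sum.abs_summable_on_def infsetsum_def)

lemma ell2_eq: "ell2 = sq_integrable ints"
  by (simp add: ell2_def sq_integrable_def integrable_count_space_iff)

lemma ell2_norm_eq: "c \<in> ell2 \<Longrightarrow> ell2_norm c = sq_norm ints c"
  by (simp add: ell2_norm_def sq_norm_def ell2_eq sq_integrable_integrable integral_count_space_eq_infsum)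

lemma ell2_inner_eq: "c \<in> ell2 \<Longrightarrow> d \<in> ell2 \<Longrightarrow> ell2_inner c d = sq_inner ints c d"
  by (simp add: ell2_inner_def sq_inner_def ell2_eq integrable_mult_cnj integral_count_space_eq_infsum)

subsection \<open>The Fourier extension operator\<close>

lemma finite_measure_lebesgue_on_interval: "finite_measure (lebesgue_on {a..b::real})"
  by (intro finite_measureI) (simp add: emeasure_restrict_space emeasure_lborel_Icc_eq)

lemma continuous_sq_integrable:
  fixes g :: "real \<Rightarrow> complex"
  assumes "continuous_on {a..b} g"
  shows "g \<in> sq_integrable (lebesgue_on {a..b})"
proof -
  have "integrable (lebesgue_on {a..b}) (\<lambda>x. (cmod (g x))\<^sup>2)"
    using assms by (intro continuous_imp_integrable_real continuous_intros)
  then show ?thesis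
    using continuous_imp_measurable_on_sets_lebesgue[OF assms] by (simp add: sq_integrable_def)
qed

text \<open>Monotonicity in the domain is taken from the gauge integral, which agrees with the
  Lebesgue integral for these integrable squares. It serves to compare the norm on the interval with
  that on a full period.\<close>

lemma sq_norm_lebesgue_on_mono:
  fixes g :: "real \<Rightarrow> complex"
  assumes "continuous_on {a..b} g" "a \<le> c" "d \<le> b"
  shows "sq_norm (lebesgue_on {c..d}) g \<le> sq_norm (lebesgue_on {a..b}) g"
proof -
  have sub: "{c..d} \<subseteq> {a..b}" using assms by auto
  have ci: "integrable (lebesgue_on {c..d}) (\<lambda>x. (cmod (g x))\<^sup>2)"
    using assms sub by (intro sq_integrable_integrable continuous_sq_integrable) (rule continuous_on_subset)
  have ai: "integrable (lebesgue_on {a..b}) (\<lambda>x. (cmod (g x))\<^sup>2)"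
    using assms by (intro sq_integrable_integrable continuous_sq_integrable)
  have "integral {c..d} (\<lambda>x. (cmod (g x))\<^sup>2) \<le> integral {a..b} (\<lambda>x. (cmod (g x))\<^sup>2)"
    using assms continuous_on_subset[OF assms(1) sub]
    by (intro integral_subset_le sub integrable_continuous_real continuous_intros) auto
  then show ?thesis
    unfolding sq_norm_def using ci ai by (simp add: lebesgue_integral_eq_integral)
qed

lemma phi_altdef:
  "phi T l x = (if l = 0 then of_real (1 / sqrt 2) else 1) * exp (\<i> * of_real (pi / T * of_int l * x))"
  by (simp add: phi_def)

lemma continuous_on_phi [continuous_intros]: "continuous_on S (phi T l)"
  unfolding phi_altdef[abs_def] by (intro continuous_intros)

lemma phi_L2: "phi T l \<in> sq_integrable (lebesgue_on {a..b})"
  by (intro continuous_sq_integrable continuous_intros)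

lemma integral_exp_period:
  fixes T :: real and n :: int
  assumes "T > 0" "n \<noteq> 0"
  shows "(LINT x|lebesgue_on {-T..T}. exp (\<i> * of_real (pi / T * of_int n * x))) = 0"
proof -
  define a where "a = pi / T * of_int n"
  have a: "a \<noteq> 0" using assms by (simp add: a_def)
  have c: "continuous_on {-T..T} (\<lambda>x. exp (\<i> * of_real (a * x)))"
    by (intro continuous_intros)
  have "((\<lambda>x. exp (\<i> * of_real (a * x)) / (\<i> * of_real a)) has_vector_derivative exp (\<i> * of_real (a * x)))
      (at x within {-T..T})" for x
    using a by (auto intro!: derivative_eq_intros has_vector_derivative_real_field simp: algebra_simps)
  then have "((\<lambda>x. exp (\<i> * of_real (a * x))) has_integral
      (exp (\<i> * of_real (a * T)) / (\<i> * of_real a) - exp (\<i> * of_real (a * (-T))) / (\<i> * of_real a))) {-T..T}"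
    using assms by (intro fundamental_theorem_of_calculus) auto
  \<comment> \<open>The two arguments differ by \<open>2 * pi * \<i> * n\<close>.\<close>
  moreover have "exp (\<i> * of_real (a * T)) = exp (\<i> * of_real (a * (-T)))"
    using assms by (subst exp_eq) (auto simp: a_def intro!: exI[of _ n])
  ultimately have "((\<lambda>x. exp (\<i> * of_real (a * x))) has_integral 0) {-T..T}" by simp
  moreover have "integrable (lebesgue_on {-T..T}) (\<lambda>x. exp (\<i> * of_real (a * x)))"
    using integrable_mult_cnj[OF continuous_sq_integrable[OF c] continuous_sq_integrable[of _ _ "\<lambda>x. 1"]] by simp
  ultimately show ?thesis
    by (simp add: lebesgue_integral_eq_integral integral_unique a_def)
qed

text \<open>Orthogonality holds on a whole period, whose length exceeds that of the interval when
  \<open>T > 1\<close>. The normalisation \<open>1 / sqrt 2\<close> at index 0 halves the squared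
  norm there.\<close>

lemma sq_inner_phi:
  assumes "T > 0"
  shows "sq_inner (lebesgue_on {-T..T}) (phi T l) (phi T m)
    = (if l = m then of_real (if l = 0 then T else 2 * T) else 0)"
proof -
  let ?k = "\<lambda>l::int. if l = 0 then complex_of_real (1 / sqrt 2) else 1"
  have "phi T l x * cnj (phi T m x) = ?k l * ?k m * exp (\<i> * of_real (pi / T * of_int (l - m) * x))" for x
  proof -
    have "exp (\<i> * of_real (pi / T * of_int l * x)) * exp (- (\<i> * of_real (pi / T * of_int m * x)))
        = exp (\<i> * complex_of_real (pi / T * of_int (l - m) * x))"
      by (simp add: algebra_simps diff_divide_distrib flip: exp_add)
    then show ?thesis unfolding phi_altdef by (simp add: exp_cnj)
  qed
  then have eq: "sq_inner (lebesgue_on {-T..T}) (phi T l) (phi T m)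
      = ?k l * ?k m * (LINT x|lebesgue_on {-T..T}. exp (\<i> * of_real (pi / T * of_int (l - m) * x)))"
    unfolding sq_inner_def by (simp only: integral_mult_right_zero)
  show ?thesis
  proof (cases "l = m")
    case True
    have "(LINT x|lebesgue_on {-T..T}. (1::complex)) = of_real (2 * T)"
      using assms by (simp add: measure_restrict_space scaleR_conv_of_real)
    moreover have "complex_of_real (sqrt 2) * complex_of_real (sqrt 2) = 2"
      by (simp flip: of_real_mult)
    ultimately show ?thesis unfolding eq using True by (simp add: field_simps)
  next
    case False
    then show ?thesis unfolding eq using integral_exp_period[OF assms, of "l - m"] by simp
  qed
qed

text \<open>Enlarging the domain to a full period can only increase the norm, and there the terms
  are orthogonal with squared norms at most \<open>2 * T\<close>. In the language of frames,
  \<open>2 * T\<close> is an upper frame bound.\<close>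

lemma sq_norm_phi_sum:
  assumes "T \<ge> 1" "finite A"
  shows "(sq_norm Lam1 (\<lambda>x. \<Sum>l\<in>A. c l * phi T l x))\<^sup>2 \<le> 2 * T * (\<Sum>l\<in>A. (cmod (c l))\<^sup>2)"
proof -
  have "sq_norm Lam1 (\<lambda>x. \<Sum>l\<in>A. c l * phi T l x) \<le> sq_norm (lebesgue_on {-T..T}) (\<lambda>x. \<Sum>l\<in>A. c l * phi T l x)"
    using assms by (intro sq_norm_lebesgue_on_mono continuous_intros) auto
  then have "(sq_norm Lam1 (\<lambda>x. \<Sum>l\<in>A. c l * phi T l x))\<^sup>2
      \<le> (sq_norm (lebesgue_on {-T..T}) (\<lambda>x. \<Sum>l\<in>A. c l * phi T l x))\<^sup>2"
    by (intro power_mono sq_norm_nonneg)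
  also have "\<dots> = (\<Sum>l\<in>A. (cmod (c l))\<^sup>2 * (if l = 0 then T else 2 * T))"
    using assms by (intro sq_norm_orthogonal_sum phi_L2 sq_inner_phi) auto
  also have "\<dots> \<le> (\<Sum>l\<in>A. (cmod (c l))\<^sup>2 * (2 * T))"
    using assms by (intro sum_mono mult_left_mono) auto
  also have "\<dots> = 2 * T * (\<Sum>l\<in>A. (cmod (c l))\<^sup>2)"
    by (simp add: sum_distrib_left mult_ac)
  finally show ?thesis .
qed

section \<open>The Fourier series as a limit along finite index sets\<close>

text \<open>The relation holds for every representative of the limit. Bounds and linearity are
  proved for it and reach the chosen representative \<open>fourier_op\<close> through uniqueness
  almost everywhere.\<close>

definition fourier_limit :: "real \<Rightarrow> (int \<Rightarrow> complex) \<Rightarrow> (real \<Rightarrow> complex) \<Rightarrow> bool" where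
  "fourier_limit T c g \<longleftrightarrow> g \<in> sq_integrable Lam1 \<and>
     ((\<lambda>A. sq_norm Lam1 (\<lambda>x. (\<Sum>l\<in>A. c l * phi T l x) - g x)) \<longlongrightarrow> 0) (finite_subsets_at_top UNIV)"

lemma phi_sum_L2: "(\<lambda>x. \<Sum>l\<in>A. c l * phi T l x) \<in> sq_integrable (lebesgue_on {a..b})"
  by (intro sq_integrable_sum phi_L2)

lemma sum_le_sq_norm_ints:
  assumes "c \<in> sq_integrable ints" "finite A"
  shows "(\<Sum>l\<in>A. (cmod (c l))\<^sup>2) \<le> (sq_norm ints c)\<^sup>2"
proof -
  have i: "integrable ints (\<lambda>l. (cmod (c l))\<^sup>2)" using assms by (simp add: sq_integrable_integrable)
  then have "(\<lambda>l. (cmod (c l))\<^sup>2) summable_on UNIV" by (simp add: integrable_count_space_iff)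
  then show ?thesis
    unfolding sq_norm_power2 integral_count_space_eq_infsum[OF i]
    using assms by (intro finite_sum_le_infsum) auto
qed

text \<open>Smallness is stated for finite sets disjoint from \<open>F\<close> because the symmetric
  difference of two finite index sets containing \<open>F\<close> is of this kind.\<close>

lemma ell2_tail_small:
  assumes "c \<in> sq_integrable ints" "e > 0"
  obtains F where "finite F"
    "\<And>A. finite A \<Longrightarrow> A \<inter> F = {} \<Longrightarrow> (\<Sum>l\<in>A. (cmod (c l))\<^sup>2) < e"
proof -
  let ?q = "\<lambda>l. (cmod (c l))\<^sup>2"
  have i: "integrable ints ?q" using assms by (simp add: sq_integrable_integrable)
  then have sm: "?q summable_on UNIV" by (simp add: integrable_count_space_iff)
  from infsum_finite_approximation[OF sm, of "e / 2"] assms(2) obtain F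
    where F: "finite F" "dist (sum ?q F) (infsum ?q UNIV) \<le> e / 2" by auto
  show thesis
  proof (rule that[OF F(1)])
    fix A assume A: "finite A" "A \<inter> F = {}"
    have "sum ?q A + sum ?q F = sum ?q (A \<union> F)"
      using A F by (simp add: sum.union_disjoint)
    also have "\<dots> \<le> infsum ?q UNIV"
      using A F sm by (intro finite_sum_le_infsum) auto
    finally show "sum ?q A < e" using F(2) assms(2) unfolding dist_real_def by linarith
  qed
qed

lemma sq_norm_phi_sum_diff:
  assumes "T \<ge> 1" "finite A" "finite B" "F \<subseteq> A" "F \<subseteq> B"
    and tail: "\<And>D. finite D \<Longrightarrow> D \<inter> F = {} \<Longrightarrow> (\<Sum>l\<in>D. (cmod (c l))\<^sup>2) < e"
  shows "(sq_norm Lam1 (\<lambda>x. (\<Sum>l\<in>A. c l * phi T l x) - (\<Sum>l\<in>B. c l * phi T l x)))\<^sup>2 \<le> 2 * T * e"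
proof -
  \<comment> \<open>\<open>?d\<close> is \<open>c\<close> on \<open>A - B\<close>, its negative on
    \<open>B - A\<close>, and 0 on the intersection, hence on \<open>F\<close>.\<close>
  let ?d = "\<lambda>l. (if l \<in> A then c l else 0) - (if l \<in> B then c l else 0)"
  have "(\<Sum>l\<in>A. c l * phi T l x) - (\<Sum>l\<in>B. c l * phi T l x) = (\<Sum>l\<in>A \<union> B. ?d l * phi T l x)" for x
  proof -
    have "(\<Sum>l\<in>A. c l * phi T l x) = (\<Sum>l\<in>A \<union> B. (if l \<in> A then c l else 0) * phi T l x)"
      "(\<Sum>l\<in>B. c l * phi T l x) = (\<Sum>l\<in>A \<union> B. (if l \<in> B then c l else 0) * phi T l x)"
      using assms by (intro sum.mono_neutral_cong_left; auto)+
    then show ?thesis by (simp only: left_diff_distrib sum_subtractf)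
  qed
  then have "(sq_norm Lam1 (\<lambda>x. (\<Sum>l\<in>A. c l * phi T l x) - (\<Sum>l\<in>B. c l * phi T l x)))\<^sup>2
      \<le> 2 * T * (\<Sum>l\<in>A \<union> B. (cmod (?d l))\<^sup>2)"
    using sq_norm_phi_sum[OF assms(1), of "A \<union> B" ?d] assms by simp
  also have "(\<Sum>l\<in>A \<union> B. (cmod (?d l))\<^sup>2) = (\<Sum>l\<in>A \<union> B - F. (cmod (?d l))\<^sup>2)"
    using assms by (intro sum.mono_neutral_right) auto
  also have "\<dots> \<le> (\<Sum>l\<in>A \<union> B - F. (cmod (c l))\<^sup>2)"
    by (intro sum_mono) auto
  also have "\<dots> \<le> e"
    using assms by (intro less_imp_le tail) auto
  finally show ?thesis using assms by simp
qed

text \<open>Finite index sets form a net, while Riesz-Fischer handles sequences. Symmetric intervals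
  are cofinal among them, so a limit along the intervals exists, and the Cauchy property makes it
  the limit of the whole net.\<close>

lemma fourier_limit_exists:
  assumes "T \<ge> 1" "c \<in> sq_integrable ints"
  shows "\<exists>g. fourier_limit T c g"
proof -
  define S where "S A x = (\<Sum>l\<in>A. c l * phi T l x)" for A x
  have S: "S A \<in> sq_integrable Lam1" for A unfolding S_def[abs_def] by (rule phi_sum_L2)
  have small: "\<exists>F. finite F \<and> (\<forall>A B. finite A \<longrightarrow> finite B \<longrightarrow> F \<subseteq> A \<longrightarrow> F \<subseteq> B \<longrightarrow>
      sq_norm Lam1 (\<lambda>x. S A x - S B x) < e)" if e: "e > 0" for e
  proof -
    \<comment> \<open>Chosen so that the factor \<open>2 * T\<close> of the partial-sum estimate
      cancels and leaves \<open>(e / 2)\<^sup>2\<close>.\<close>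
    have "(e / 2)\<^sup>2 / (2 * T) > 0" using e assms by simp
    then obtain F where F: "finite F"
      "\<And>A. finite A \<Longrightarrow> A \<inter> F = {} \<Longrightarrow> (\<Sum>l\<in>A. (cmod (c l))\<^sup>2) < (e / 2)\<^sup>2 / (2 * T)"
      by (rule ell2_tail_small[OF assms(2)]) (rule that)
    have "sq_norm Lam1 (\<lambda>x. S A x - S B x) < e"
      if "finite A" "finite B" "F \<subseteq> A" "F \<subseteq> B" for A B
    proof -
      have "(sq_norm Lam1 (\<lambda>x. S A x - S B x))\<^sup>2 \<le> 2 * T * ((e / 2)\<^sup>2 / (2 * T))"
        unfolding S_def by (rule sq_norm_phi_sum_diff[OF assms(1) that]) (rule F(2))
      also have "\<dots> = (e / 2)\<^sup>2"
        using assms(1) by (subst times_divide_eq_right, subst nonzero_mult_div_cancel_left) auto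
      finally have "(sq_norm Lam1 (\<lambda>x. S A x - S B x))\<^sup>2 \<le> (e / 2)\<^sup>2" .
      then have "sq_norm Lam1 (\<lambda>x. S A x - S B x) \<le> e / 2"
        using e by (rule power2_le_imp_le[OF _ less_imp_le[OF half_gt_zero]])
      with e show ?thesis by linarith
    qed
    with F(1) show ?thesis by (intro exI[of _ F] conjI allI impI)
  qed
  define I where "I n = {- int n..int n}" for n
  have cover: "\<exists>N. \<forall>n\<ge>N. F \<subseteq> I n" if "finite F" for F
  proof (intro exI allI impI subsetI)
    fix n l assume n: "nat (Max (abs ` F)) \<le> n" and l: "l \<in> F"
    have "\<bar>l\<bar> \<le> Max (abs ` F)" using that l by (intro Max_ge) auto
    with n have "\<bar>l\<bar> \<le> int n" by linarith
    then show "l \<in> I n" unfolding I_def by (simp add: abs_le_iff)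
  qed
  have "\<exists>g\<in>sq_integrable Lam1. (\<lambda>n. sq_norm Lam1 (\<lambda>x. S (I n) x - g x)) \<longlonglongrightarrow> 0"
  proof (rule Riesz_Fischer[OF finite_measure_lebesgue_on_interval S])
    fix e :: real assume "e > 0"
    from small[OF this] obtain F where F: "finite F"
      "\<forall>A B. finite A \<longrightarrow> finite B \<longrightarrow> F \<subseteq> A \<longrightarrow> F \<subseteq> B \<longrightarrow> sq_norm Lam1 (\<lambda>x. S A x - S B x) < e"
      by (elim exE conjE) (rule that)
    from cover[OF F(1)] obtain N where "\<forall>n\<ge>N. F \<subseteq> I n" by blast
    then have "sq_norm Lam1 (\<lambda>x. S (I m) x - S (I n) x) < e" if "m \<ge> N" "n \<ge> N" for m n
      using that by (intro F(2)[rule_format]) (simp_all add: I_def)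
    then show "\<exists>N. \<forall>m\<ge>N. \<forall>n\<ge>N. sq_norm Lam1 (\<lambda>x. S (I m) x - S (I n) x) < e" by blast
  qed
  then obtain g where g: "g \<in> sq_integrable Lam1"
    and lim: "(\<lambda>n. sq_norm Lam1 (\<lambda>x. S (I n) x - g x)) \<longlonglongrightarrow> 0" by blast
  have "((\<lambda>A. sq_norm Lam1 (\<lambda>x. S A x - g x)) \<longlongrightarrow> 0) (finite_subsets_at_top UNIV)"
  proof (rule tendstoI)
    fix e :: real assume "e > 0"
    then have "e / 2 > 0" by simp
    from small[OF this] obtain F where F: "finite F"
      "\<forall>A B. finite A \<longrightarrow> finite B \<longrightarrow> F \<subseteq> A \<longrightarrow> F \<subseteq> B \<longrightarrow> sq_norm Lam1 (\<lambda>x. S A x - S B x) < e / 2"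
      by (elim exE conjE) (rule that)
    from cover[OF F(1)] obtain N where N: "\<forall>n\<ge>N. F \<subseteq> I n" by blast
    have "sq_norm Lam1 (\<lambda>x. S A x - g x) < e" if A: "finite A" "F \<subseteq> A" for A
    proof -
      have "\<forall>\<^sub>F n in sequentially. sq_norm Lam1 (\<lambda>x. S (I n) x - g x) < e / 2"
        using lim \<open>e / 2 > 0\<close> by (rule order_tendstoD)
      then obtain M where "\<forall>n\<ge>M. sq_norm Lam1 (\<lambda>x. S (I n) x - g x) < e / 2"
        by (auto simp: eventually_sequentially)
      then have "sq_norm Lam1 (\<lambda>x. S (I (max M N)) x - g x) < e / 2" by simp
      moreover have "sq_norm Lam1 (\<lambda>x. S A x - S (I (max M N)) x) < e / 2"
        using A N by (intro F(2)[rule_format]) (simp_all add: I_def)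
      ultimately show ?thesis
        using sq_norm_triangle_diff[OF S S g, of A "I (max M N)"] by linarith
    qed
    then show "\<forall>\<^sub>F A in finite_subsets_at_top UNIV. dist (sq_norm Lam1 (\<lambda>x. S A x - g x)) 0 < e"
      unfolding eventually_finite_subsets_at_top
      using F(1) by (intro exI[of _ F]) (simp add: sq_norm_nonneg)
  qed
  with g show ?thesis unfolding fourier_limit_def S_def by blast
qed

lemma fourier_limit_fourier_op:
  assumes "T \<ge> 1" "c \<in> sq_integrable ints"
  shows "fourier_limit T c (fourier_op T c)"
  using someI_ex[OF fourier_limit_exists[OF assms]]
  unfolding fourier_op_def fourier_limit_def L2_eq L2_norm_eq .

lemma fourier_op_L2:
  assumes "T \<ge> 1" "c \<in> sq_integrable ints"
  shows "fourier_op T c \<in> sq_integrable Lam1"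
  using fourier_limit_fourier_op[OF assms] by (simp add: fourier_limit_def)

lemma fourier_limit_unique:
  assumes "fourier_limit T c g" "fourier_limit T c k"
  shows "AE x in Lam1. g x = k x"
proof -
  let ?S = "\<lambda>A x. \<Sum>l\<in>A. c l * phi T l x"
  have g: "g \<in> sq_integrable Lam1" and k: "k \<in> sq_integrable Lam1"
    using assms by (auto simp: fourier_limit_def)
  have "((\<lambda>A. sq_norm Lam1 (\<lambda>x. ?S A x - g x) + sq_norm Lam1 (\<lambda>x. ?S A x - k x)) \<longlongrightarrow> 0 + 0)
      (finite_subsets_at_top UNIV)"
    using assms unfolding fourier_limit_def by (intro tendsto_add) auto
  moreover have "sq_norm Lam1 (\<lambda>x. g x - k x)
      \<le> sq_norm Lam1 (\<lambda>x. ?S A x - g x) + sq_norm Lam1 (\<lambda>x. ?S A x - k x)" for A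
    using sq_norm_triangle_diff[OF g phi_sum_L2[of c T A] k] by (simp add: sq_norm_minus_commute)
  ultimately have "sq_norm Lam1 (\<lambda>x. g x - k x) \<le> 0 + 0"
    by (intro tendsto_lowerbound[OF _ always_eventually]) auto
  then have "sq_norm Lam1 (\<lambda>x. g x - k x) = 0"
    using sq_norm_nonneg[of Lam1 "\<lambda>x. g x - k x"] by simp
  from sq_norm_eq_0_AE[OF sq_integrable_diff[OF g k] this] show ?thesis by simp
qed

lemma fourier_limit_add_scale:
  assumes "fourier_limit T c g" "fourier_limit T d k"
  shows "fourier_limit T (\<lambda>l. c l + a * d l) (\<lambda>x. g x + a * k x)"
proof -
  let ?S = "\<lambda>c A x. \<Sum>l\<in>A. c l * phi T l x"
  have g: "g \<in> sq_integrable Lam1" and k: "k \<in> sq_integrable Lam1"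
    using assms by (auto simp: fourier_limit_def)
  have "((\<lambda>A. sq_norm Lam1 (\<lambda>x. ?S c A x - g x) + cmod a * sq_norm Lam1 (\<lambda>x. ?S d A x - k x))
      \<longlongrightarrow> 0 + cmod a * 0) (finite_subsets_at_top UNIV)"
    using assms unfolding fourier_limit_def by (intro tendsto_intros) auto
  then have lim: "((\<lambda>A. sq_norm Lam1 (\<lambda>x. ?S c A x - g x) + cmod a * sq_norm Lam1 (\<lambda>x. ?S d A x - k x))
      \<longlongrightarrow> 0) (finite_subsets_at_top UNIV)" by simp
  have "sq_norm Lam1 (\<lambda>x. ?S (\<lambda>l. c l + a * d l) A x - (g x + a * k x))
      \<le> sq_norm Lam1 (\<lambda>x. ?S c A x - g x) + cmod a * sq_norm Lam1 (\<lambda>x. ?S d A x - k x)" for A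
  proof -
    have "?S (\<lambda>l. c l + a * d l) A x - (g x + a * k x) = (?S c A x - g x) + a * (?S d A x - k x)" for x
      by (simp add: algebra_simps sum.distrib sum_distrib_left)
    moreover have "sq_norm Lam1 (\<lambda>x. (?S c A x - g x) + a * (?S d A x - k x))
        \<le> sq_norm Lam1 (\<lambda>x. ?S c A x - g x) + sq_norm Lam1 (\<lambda>x. a * (?S d A x - k x))"
      by (intro sq_norm_triangle sq_integrable_scale sq_integrable_diff phi_sum_L2 g k)
    ultimately show ?thesis by (simp only: sq_norm_scale)
  qed
  then have "((\<lambda>A. sq_norm Lam1 (\<lambda>x. ?S (\<lambda>l. c l + a * d l) A x - (g x + a * k x))) \<longlongrightarrow> 0)
      (finite_subsets_at_top UNIV)"
    by (intro tendsto_sandwich[OF _ _ tendsto_const lim] always_eventually) (auto simp: sq_norm_nonneg)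
  then show ?thesis
    using g k by (auto simp: fourier_limit_def intro: sq_integrable_add sq_integrable_scale)
qed

text \<open>The bound is uniform over all finite partial sums, so it survives the limit.\<close>

lemma fourier_limit_bound:
  assumes "T \<ge> 1" "c \<in> sq_integrable ints" "fourier_limit T c g"
  shows "sq_norm Lam1 g \<le> sqrt (2 * T) * sq_norm ints c"
proof -
  let ?S = "\<lambda>A x. \<Sum>l\<in>A. c l * phi T l x"
  have g: "g \<in> sq_integrable Lam1" using assms by (auto simp: fourier_limit_def)
  have S: "sq_norm Lam1 (?S A) \<le> sqrt (2 * T) * sq_norm ints c" if "finite A" for A
  proof (rule power2_le_imp_le)
    have "(sq_norm Lam1 (?S A))\<^sup>2 \<le> 2 * T * (\<Sum>l\<in>A. (cmod (c l))\<^sup>2)"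
      using assms(1) that by (rule sq_norm_phi_sum)
    also have "\<dots> \<le> 2 * T * (sq_norm ints c)\<^sup>2"
      using assms that by (intro mult_left_mono sum_le_sq_norm_ints) auto
    finally show "(sq_norm Lam1 (?S A))\<^sup>2 \<le> (sqrt (2 * T) * sq_norm ints c)\<^sup>2"
      using assms(1) by (simp add: power_mult_distrib)
  qed (use assms in \<open>simp add: sq_norm_nonneg\<close>)
  have "((\<lambda>A. sq_norm Lam1 (\<lambda>x. ?S A x - g x) + sqrt (2 * T) * sq_norm ints c) \<longlongrightarrow>
      0 + sqrt (2 * T) * sq_norm ints c) (finite_subsets_at_top UNIV)"
    using assms unfolding fourier_limit_def by (intro tendsto_intros) auto
  moreover have "\<forall>\<^sub>F A in finite_subsets_at_top UNIV.
      sq_norm Lam1 g \<le> sq_norm Lam1 (\<lambda>x. ?S A x - g x) + sqrt (2 * T) * sq_norm ints c"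
  proof (rule eventually_finite_subsets_at_top_weakI)
    fix A :: "int set" assume A: "finite A"
    have "sq_norm Lam1 g \<le> sq_norm Lam1 (\<lambda>x. g x - ?S A x) + sq_norm Lam1 (?S A)"
      using sq_norm_triangle_diff[OF g phi_sum_L2[of c T A] sq_integrable_zero] by simp
    then show "sq_norm Lam1 g \<le> sq_norm Lam1 (\<lambda>x. ?S A x - g x) + sqrt (2 * T) * sq_norm ints c"
      using S[OF A] by (simp add: sq_norm_minus_commute)
  qed
  ultimately have "sq_norm Lam1 g \<le> 0 + sqrt (2 * T) * sq_norm ints c"
    by (intro tendsto_lowerbound) auto
  then show ?thesis by simp
qed

lemma fourier_op_bound:
  assumes "T \<ge> 1" "c \<in> sq_integrable ints"
  shows "sq_norm Lam1 (fourier_op T c) \<le> sqrt (2 * T) * sq_norm ints c"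
  using assms by (intro fourier_limit_bound fourier_limit_fourier_op)

lemma fourier_op_add_scale:
  assumes "T \<ge> 1" "c \<in> sq_integrable ints" "d \<in> sq_integrable ints"
  shows "AE x in Lam1. fourier_op T (\<lambda>l. c l + a * d l) x = fourier_op T c x + a * fourier_op T d x"
proof (rule fourier_limit_unique)
  show "fourier_limit T (\<lambda>l. c l + a * d l) (fourier_op T (\<lambda>l. c l + a * d l))"
    using assms by (intro fourier_limit_fourier_op sq_integrable_add sq_integrable_scale)
  show "fourier_limit T (\<lambda>l. c l + a * d l) (\<lambda>x. fourier_op T c x + a * fourier_op T d x)"
    using assms by (intro fourier_limit_add_scale fourier_limit_fourier_op)
qed

lemma indicator_ints: "(\<lambda>l. if l = m then 1 else 0) \<in> sq_integrable ints"
proof -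
  have "(\<lambda>l. if l = m then 1 else (0::real)) summable_on UNIV \<longleftrightarrow> (\<lambda>l. 1::real) summable_on {m}"
    by (intro summable_on_cong_neutral) auto
  then have "integrable ints (\<lambda>l. if l = m then 1 else (0::real))"
    by (simp add: integrable_count_space_iff if_distrib cong: if_cong)
  moreover have "(\<lambda>l. (cmod (if l = m then 1 else 0))\<^sup>2) = (\<lambda>l. if l = m then 1 else (0::real))"
    by auto
  ultimately show ?thesis by (simp add: sq_integrable_def)
qed

text \<open>Partial sums over finite sets containing \<open>m\<close> equal \<open>phi T m\<close>
  exactly. Together with linearity this describes the effect of changing one coefficient.\<close>

lemma fourier_limit_phi: "fourier_limit T (\<lambda>l. if l = m then 1 else 0) (phi T m)"
proof -
  let ?S = "\<lambda>A x. \<Sum>l\<in>A. (if l = m then 1 else 0) * phi T l x"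
  have "\<forall>\<^sub>F A in finite_subsets_at_top UNIV. sq_norm Lam1 (\<lambda>x. ?S A x - phi T m x) = 0"
    unfolding eventually_finite_subsets_at_top
  proof (intro exI[of _ "{m}"] conjI allI impI)
    fix A :: "int set" assume "finite A \<and> {m} \<subseteq> A \<and> A \<subseteq> UNIV"
    then have "?S A x = phi T m x" for x
      using sum.remove[of A m "\<lambda>l. (if l = m then 1 else 0) * phi T l x"] by auto
    then show "sq_norm Lam1 (\<lambda>x. ?S A x - phi T m x) = 0" by (simp add: sq_norm_def)
  qed auto
  then show ?thesis
    unfolding fourier_limit_def by (auto intro: phi_L2 tendsto_eventually)
qed

subsection \<open>Totality of the exponentials\<close>

text \<open>This is the linear span of the exponentials, without the special normalisation at index
  0, so that products merely add frequencies. The inductive form yields closure under products by a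
  nested induction.\<close>

inductive trig_poly :: "real \<Rightarrow> (real \<Rightarrow> complex) \<Rightarrow> bool" for T where
  monom: "trig_poly T (\<lambda>x. a * exp (\<i> * of_real (pi / T * of_int l * x)))"
| add: "trig_poly T p \<Longrightarrow> trig_poly T q \<Longrightarrow> trig_poly T (\<lambda>x. p x + q x)"

lemma trig_poly_mult:
  assumes "trig_poly T p" "trig_poly T q"
  shows "trig_poly T (\<lambda>x. p x * q x)"
  using assms(1)
proof induction
  case p: (monom a l)
  show ?case
    using assms(2)
  proof induction
    case (monom b m)
    have eq: "a * exp (\<i> * of_real (pi / T * of_int l * x)) * (b * exp (\<i> * of_real (pi / T * of_int m * x)))
        = (a * b) * exp (\<i> * of_real (pi / T * of_int (l + m) * x))" for x
      by (simp add: algebra_simps add_divide_distrib exp_add)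
    then show ?case using trig_poly.monom[of T "a * b" "l + m"] by (simp only: eq)
  next
    case (add q r)
    then show ?case by (simp add: distrib_left trig_poly.add)
  qed
next
  case (add p r)
  then show ?case by (simp add: distrib_right trig_poly.add)
qed

lemma continuous_on_trig_poly: "trig_poly T p \<Longrightarrow> continuous_on S p"
  by (induction rule: trig_poly.induct) (intro continuous_intros; assumption)+

lemma trig_poly_const: "trig_poly T (\<lambda>x. c)"
  using trig_poly.monom[of T c 0] by simp

lemma trig_poly_cos: "trig_poly T (\<lambda>x. of_real (cos (pi / T * x)))"
proof -
  have "of_real (cos (pi / T * x)) = 1 / 2 * exp (\<i> * of_real (pi / T * of_int 1 * x))
      + 1 / 2 * exp (\<i> * of_real (pi / T * of_int (-1) * x))" for x
    by (simp add: cos_exp_eq field_simps flip: cos_of_real)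
  then show ?thesis
    using trig_poly.add[OF trig_poly.monom[of T "1/2" 1] trig_poly.monom[of T "1/2" "-1"]] by simp
qed

lemma trig_poly_sin: "trig_poly T (\<lambda>x. of_real (sin (pi / T * x)))"
proof -
  have "of_real (sin (pi / T * x)) = 1 / (2 * \<i>) * exp (\<i> * of_real (pi / T * of_int 1 * x))
      + - (1 / (2 * \<i>)) * exp (\<i> * of_real (pi / T * of_int (-1) * x))" for x
    by (simp add: sin_exp_eq field_simps flip: sin_of_real)
  then show ?thesis
    using trig_poly.add[OF trig_poly.monom[of T "1/(2*\<i>)" 1] trig_poly.monom[of T "-(1/(2*\<i>))" "-1"]] by simp
qed

text \<open>Only here does \<open>T > 1\<close> matter: for \<open>T = 1\<close> the endpoints are not separated.\<close>
lemma cos_sin_separate: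
  assumes "T > 1" "x \<in> {-1..1}" "y \<in> {-1..1}"
    and "cos (pi / T * x) = cos (pi / T * y)" "sin (pi / T * x) = sin (pi / T * y)"
  shows "x = y"
proof -
  from assms(4,5) obtain n :: int where "pi / T * x = pi / T * y + 2 * pi * n"
    using sin_cos_eq_iff by metis
  then have "pi * x = pi * (y + 2 * T * n)" using assms(1) by (simp add: field_simps)
  then have eq: "x = y + 2 * T * n" by simp
  have "n = 0"
  proof (rule ccontr)
    assume "n \<noteq> 0"
    then have "1 \<le> \<bar>real_of_int n\<bar>" by linarith
    then have "2 * T * 1 \<le> 2 * T * \<bar>real_of_int n\<bar>" using assms(1) by (intro mult_left_mono) auto
    also have "\<dots> = \<bar>x - y\<bar>" using eq assms(1) by (simp add: abs_mult)
    also have "\<dots> \<le> 2" using assms(2,3) by auto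
    finally show False using assms(1) by simp
  qed
  with eq show ?thesis by simp
qed

text \<open>Stone-Weierstrass is applied in its real form, to the real functions whose complex
  embedding is a trigonometric polynomial. They inherit constants, sums and products, and cosine and
  sine together separate points.\<close>

lemma trig_poly_dense:
  fixes p :: "real \<Rightarrow> real"
  assumes "T > 1" "continuous_on {-1..1} p" "e > 0"
  shows "\<exists>q. trig_poly T (\<lambda>x. of_real (q x)) \<and> (\<forall>x\<in>{-1..1}. \<bar>p x - q x\<bar> < e)"
proof (rule Stone_Weierstrass_HOL[where P = "\<lambda>q. trig_poly T (\<lambda>x. of_real (q x))"])
  show "\<And>q. trig_poly T (\<lambda>x. of_real (q x)) \<Longrightarrow> continuous_on {-1..1} q"
    using continuous_on_trig_poly continuous_on_Re by fastforce
  show "\<And>x y. x \<in> {-1..1} \<and> y \<in> {-1..1} \<and> x \<noteq> y \<Longrightarrow>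
      \<exists>f. trig_poly T (\<lambda>x. of_real (f x)) \<and> f x \<noteq> f y"
    using cos_sin_separate[OF assms(1)] trig_poly_cos trig_poly_sin by metis
qed (use assms in \<open>auto intro: trig_poly_const trig_poly.add trig_poly_mult\<close>)

lemma L2_integrable:
  assumes "r \<in> sq_integrable Lam1"
  shows "integrable Lam1 r"
  using integrable_mult_cnj[OF assms continuous_sq_integrable[of "-1" 1 "\<lambda>x. 1"]] by simp

lemma L2_integrable_mult:
  fixes s :: "real \<Rightarrow> real"
  assumes "r \<in> sq_integrable Lam1" "s \<in> borel_measurable Lam1" "\<And>x. x \<in> {-1..1} \<Longrightarrow> \<bar>s x\<bar> \<le> B"
  shows "integrable Lam1 (\<lambda>x. r x * of_real (s x))"
proof (rule Bochner_Integration.integrable_bound)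
  show "integrable Lam1 (\<lambda>x. of_real B * r x)"
    using L2_integrable[OF assms(1)] by simp
  show "(\<lambda>x. r x * of_real (s x)) \<in> borel_measurable Lam1"
    using assms(2) sq_integrable_measurable[OF assms(1)] by measurable
  show "AE x in Lam1. norm (r x * of_real (s x)) \<le> norm (of_real B * r x)"
  proof (rule AE_I2)
    fix x assume "x \<in> space Lam1"
    then have "\<bar>s x\<bar> \<le> \<bar>B\<bar>" using assms(3)[of x] by (auto intro: order_trans)
    then show "norm (r x * of_real (s x)) \<le> norm (of_real B * r x)"
      by (simp add: norm_mult mult.commute mult_right_mono)
  qed
qed

text \<open>\<open>sq_inner\<close> conjugates its second argument and the integral here does not,
  so frequency \<open>l\<close> is tested with index \<open>-l\<close>.\<close>

lemma orthogonal_trig_poly: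
  assumes r: "r \<in> sq_integrable Lam1" and orth: "\<And>l. sq_inner Lam1 r (phi T l) = 0"
    and p: "trig_poly T p"
  shows "(LINT x|Lam1. r x * p x) = 0"
  using p
proof induction
  case (monom a l)
  \<comment> \<open>Undoes the factor \<open>1 / sqrt 2\<close> in \<open>phi T 0\<close>.\<close>
  let ?k = "if l = 0 then sqrt 2 else 1"
  have "r x * (a * exp (\<i> * of_real (pi / T * of_int l * x)))
      = a * of_real ?k * (r x * cnj (phi T (-l) x))" for x
    by (simp add: phi_def exp_cnj field_simps)
  then have "(LINT x|Lam1. r x * (a * exp (\<i> * of_real (pi / T * of_int l * x))))
      = a * of_real ?k * sq_inner Lam1 r (phi T (-l))"
    unfolding sq_inner_def by (simp only: integral_mult_right_zero)
  then show ?case by (simp add: orth)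
next
  case (add p q)
  have "integrable Lam1 (\<lambda>x. r x * w x)" if "trig_poly T w" for w
    using integrable_mult_cnj[OF r continuous_sq_integrable[of "-1" 1 "\<lambda>x. cnj (w x)"]]
      continuous_on_trig_poly[OF that] by (simp add: continuous_intros)
  then show ?case using add by (simp add: distrib_left)
qed

lemma orthogonal_continuous:
  fixes p :: "real \<Rightarrow> real"
  assumes T: "T > 1" and r: "r \<in> sq_integrable Lam1" and orth: "\<And>l. sq_inner Lam1 r (phi T l) = 0"
    and p: "continuous_on {-1..1} p"
  shows "(LINT x|Lam1. r x * of_real (p x)) = 0"
proof (rule ccontr)
  let ?I = "LINT x|Lam1. r x * of_real (p x)" and ?K = "LINT x|Lam1. norm (r x)"
  assume "?I \<noteq> 0"
  \<comment> \<open>With this accuracy the approximation error is at most \<open>e * ?K\<close>,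
    strictly less than \<open>e * (?K + 1) = cmod ?I\<close>; the 1 also excludes division by
    zero.\<close>
  define e where "e = cmod ?I / (?K + 1)"
  have K: "?K + 1 > 0" by (rule add_nonneg_pos) auto
  have e: "e > 0" unfolding e_def using \<open>?I \<noteq> 0\<close> K by (intro divide_pos_pos) auto
  from trig_poly_dense[OF T p e] obtain q where q: "trig_poly T (\<lambda>x. of_real (q x))"
    "\<forall>x\<in>{-1..1}. \<bar>p x - q x\<bar> < e" by blast
  have cq: "continuous_on {-1..1} q"
    using continuous_on_Re[OF continuous_on_trig_poly[OF q(1)]] by simp
  have int: "integrable Lam1 (\<lambda>x. r x * of_real (w x))" if "continuous_on {-1..1} w" for w
    using integrable_mult_cnj[OF r continuous_sq_integrable[of "-1" 1 "\<lambda>x. of_real (w x)"]] that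
    by (simp add: continuous_on_of_real)
  have "?I = ?I - (LINT x|Lam1. r x * of_real (q x))"
    using orthogonal_trig_poly[OF r orth q(1)] by simp
  also have "\<dots> = (LINT x|Lam1. r x * of_real (p x - q x))"
    using int[OF p] int[OF cq] by (simp add: right_diff_distrib)
  finally have "cmod ?I \<le> (LINT x|Lam1. norm (r x * of_real (p x - q x)))"
    using integral_norm_bound[of Lam1 "\<lambda>x. r x * of_real (p x - q x)"] by simp
  also have "\<dots> \<le> (LINT x|Lam1. e * norm (r x))"
  proof (rule integral_mono)
    show "integrable Lam1 (\<lambda>x. norm (r x * of_real (p x - q x)))"
      using p cq by (intro integrable_norm int continuous_intros)
    show "integrable Lam1 (\<lambda>x. e * norm (r x))" using L2_integrable[OF r] by simp
    fix x assume "x \<in> space Lam1"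
    then have "\<bar>p x - q x\<bar> \<le> e" using q(2) by force
    then have "norm (r x) * \<bar>p x - q x\<bar> \<le> norm (r x) * e" by (rule mult_left_mono) simp
    then show "norm (r x * of_real (p x - q x)) \<le> e * norm (r x)"
      by (simp only: norm_mult norm_of_real mult.commute)
  qed
  also have "\<dots> = e * ?K" by simp
  also have "\<dots> < e * (?K + 1)" using e by simp
  also have "\<dots> = cmod ?I" unfolding e_def using K by simp
  finally show False by simp
qed

text \<open>A measurable function is an a.e. limit of continuous ones. Once these are clipped to
  \<open>{-1..1}\<close>, which contains the values of \<open>s\<close>, \<open>norm (r x)\<close>
  dominates the integrands and orthogonality passes to the limit.\<close>

lemma orthogonal_bounded_measurable:
  fixes s :: "real \<Rightarrow> real"
  assumes T: "T > 1" and r: "r \<in> sq_integrable Lam1" and orth: "\<And>l. sq_inner Lam1 r (phi T l) = 0"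
    and s: "s \<in> borel_measurable Lam1" "\<And>x. \<bar>s x\<bar> \<le> 1"
  shows "(LINT x|Lam1. r x * of_real (s x)) = 0"
proof -
  have "(\<lambda>x. if x \<in> {-1..1} then s x else 0) \<in> borel_measurable lebesgue"
    using s(1) by (subst borel_measurable_if) auto
  then have "(\<lambda>x. if x \<in> {-1..1} then s x else 0) measurable_on UNIV"
    by (intro lebesgue_measurable_imp_measurable_on_real) auto
  then obtain N g where N: "negligible N" and g: "\<And>n. continuous_on UNIV (g n)"
    and lim: "\<And>x. x \<notin> N \<Longrightarrow> (\<lambda>n. g n x) \<longlonglongrightarrow> (if x \<in> {-1..1} then s x else 0)"
    unfolding measurable_on_def by auto
  define h where "h n x = max (-1) (min 1 (g n x))" for n x
  have hc: "continuous_on S (h n)" for n S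
    unfolding h_def using continuous_on_subset[OF g[of n], of S] by (intro continuous_intros) auto
  have hb: "\<bar>h n x\<bar> \<le> 1" for n x unfolding h_def by auto
  have rm: "r \<in> borel_measurable Lam1" using r by (rule sq_integrable_measurable)
  have hm: "h n \<in> borel_measurable Lam1" for n
    by (rule continuous_imp_measurable_on_sets_lebesgue[OF hc]) auto
  have "AE x in lebesgue. x \<notin> N"
    using N by (simp add: negligible_iff_null_sets AE_not_in)
  then have AE: "AE x in Lam1. x \<notin> N"
    by (subst AE_restrict_space_iff) (auto elim: AE_mp)
  have "(\<lambda>n. LINT x|Lam1. r x * of_real (h n x)) \<longlonglongrightarrow> (LINT x|Lam1. r x * of_real (s x))"
  proof (rule integral_dominated_convergence[where w = "\<lambda>x. norm (r x)"])
    show "(\<lambda>x. r x * of_real (s x)) \<in> borel_measurable Lam1" using rm s by measurable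
    show "(\<lambda>x. r x * of_real (h n x)) \<in> borel_measurable Lam1" for n using rm hm by measurable
    show "integrable Lam1 (\<lambda>x. norm (r x))" using L2_integrable[OF r] by simp
    show "AE x in Lam1. (\<lambda>n. r x * of_real (h n x)) \<longlonglongrightarrow> r x * of_real (s x)"
      using AE AE_space
    proof eventually_elim
      case (elim x)
      then have "(\<lambda>n. g n x) \<longlonglongrightarrow> s x" using lim[of x] by simp
      then have "(\<lambda>n. h n x) \<longlonglongrightarrow> max (-1) (min 1 (s x))"
        unfolding h_def by (intro tendsto_intros)
      moreover have "max (-1) (min 1 (s x)) = s x" using s(2)[of x] by auto
      ultimately have "(\<lambda>n. h n x) \<longlonglongrightarrow> s x" by simp
      then show ?case by (intro tendsto_intros)
    qed
    show "AE x in Lam1. norm (r x * of_real (h n x)) \<le> norm (r x)" for n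
      using hb by (intro AE_I2) (simp add: norm_mult mult_left_le)
  qed
  then show ?thesis
    by (simp add: orthogonal_continuous[OF T r orth hc] LIMSEQ_const_iff)
qed

text \<open>Test against the complex sign of \<open>r\<close>, an a.e. limit of bounded continuous functions.\<close>
theorem phi_total:
  assumes T: "T > 1" and r: "r \<in> sq_integrable Lam1" and orth: "\<And>l. sq_inner Lam1 r (phi T l) = 0"
  shows "AE x in Lam1. r x = 0"
proof -
  have rm[measurable]: "r \<in> borel_measurable Lam1" using r by (rule sq_integrable_measurable)
  define s where "s x = cnj (sgn (r x))" for x
  have sm: "s \<in> borel_measurable Lam1" unfolding s_def sgn_div_norm by measurable
  have nb: "cmod (s x) \<le> 1" for x by (simp add: s_def norm_sgn)
  \<comment> \<open>Orthogonality has been shown for real multipliers, so the two parts of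
    \<open>s\<close> are treated separately.\<close>
  have Re: "\<bar>Re (s x)\<bar> \<le> 1" and Im: "\<bar>Im (s x)\<bar> \<le> 1" for x
    using abs_Re_le_cmod[of "s x"] abs_Im_le_cmod[of "s x"] nb[of x] by linarith+
  have mRe: "(\<lambda>x. Re (s x)) \<in> borel_measurable Lam1" and mIm: "(\<lambda>x. Im (s x)) \<in> borel_measurable Lam1"
    using sm by measurable
  have "of_real (LINT x|Lam1. cmod (r x)) = (LINT x|Lam1. complex_of_real (cmod (r x)))"
    by (rule integral_complex_of_real[symmetric])
  also have "\<dots> = (LINT x|Lam1. r x * of_real (Re (s x)) + \<i> * (r x * of_real (Im (s x))))"
  proof (rule Bochner_Integration.integral_cong[OF refl])
    fix x
    have "complex_of_real (cmod (r x)) = r x * s x"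
      by (cases "r x = 0")
        (simp_all add: s_def sgn_div_norm scaleR_conv_of_real field_simps complex_norm_square[symmetric]
          power2_eq_square flip: complex_norm_square)
    also have "s x = of_real (Re (s x)) + \<i> * of_real (Im (s x))" by (rule complex_eq)
    finally show "complex_of_real (cmod (r x)) = r x * of_real (Re (s x)) + \<i> * (r x * of_real (Im (s x)))"
      by (simp add: algebra_simps)
  qed
  also have "\<dots> = (LINT x|Lam1. r x * of_real (Re (s x))) + \<i> * (LINT x|Lam1. r x * of_real (Im (s x)))"
    using L2_integrable_mult[OF r mRe Re] L2_integrable_mult[OF r mIm Im] by simp
  also have "\<dots> = 0"
    using orthogonal_bounded_measurable[OF T r orth mRe Re]
      orthogonal_bounded_measurable[OF T r orth mIm Im] by simp
  finally have "(LINT x|Lam1. cmod (r x)) = 0" by simp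
  then have "AE x in Lam1. cmod (r x) = 0"
    using L2_integrable[OF r] by (subst (asm) integral_nonneg_eq_0_iff_AE) auto
  then show ?thesis by simp
qed

section \<open>Least-squares solutions\<close>

text \<open>First-order optimality: if the inner product were nonzero, a short step along
  \<open>w\<close> against it would strictly lower the norm.\<close>

lemma orthogonal_if_minimal:
  assumes r: "r \<in> sq_integrable M" and w: "w \<in> sq_integrable M"
    and min: "\<And>t. sq_norm M r \<le> sq_norm M (\<lambda>x. r x + t * w x)"
  shows "sq_inner M r w = 0"
proof (rule ccontr)
  define z where "z = sq_inner M r w"
  \<comment> \<open>A step slightly shorter than the optimal
    \<open>1 / (sq_norm M w)\<^sup>2\<close>. Adding 1 covers \<open>w\<close> of norm 0, and the
    quadratic term stays at most half of the linear gain.\<close>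
  define s where "s = 1 / ((sq_norm M w)\<^sup>2 + 1)"
  assume "sq_inner M r w \<noteq> 0"
  then have z: "(cmod z)\<^sup>2 > 0" by (simp add: z_def)
  have d: "(sq_norm M w)\<^sup>2 + 1 > 0" by (rule add_nonneg_pos) auto
  then have s: "s > 0" by (simp add: s_def)
  have s1: "s * (sq_norm M w)\<^sup>2 \<le> 1"
    unfolding s_def using d by (simp add: divide_simps)
  let ?t = "- (of_real s * z)"
  have "(sq_norm M r)\<^sup>2 \<le> (sq_norm M (\<lambda>x. r x + ?t * w x))\<^sup>2"
    by (intro power_mono min sq_norm_nonneg)
  also have "\<dots> = (sq_norm M r)\<^sup>2 + 2 * Re (cnj ?t * z) + (cmod ?t * sq_norm M w)\<^sup>2"
    unfolding sq_norm_add_power2[OF r sq_integrable_scale[OF w]] sq_inner_scale_right sq_norm_scale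
      z_def ..
  also have "Re (cnj ?t * z) = - (s * (cmod z)\<^sup>2)"
    by (simp add: cmod_power2[unfolded power2_eq_square] power2_eq_square algebra_simps)
  also have "(cmod ?t * sq_norm M w)\<^sup>2 = (s * (cmod z)\<^sup>2) * (s * (sq_norm M w)\<^sup>2)"
    using s by (simp add: norm_mult power_mult_distrib power2_eq_square)
  also have "\<dots> \<le> (s * (cmod z)\<^sup>2) * 1"
    using s s1 by (intro mult_left_mono) auto
  finally have "s * (cmod z)\<^sup>2 \<le> 0" by linarith
  moreover have "0 < s * (cmod z)\<^sup>2" using s z by (rule mult_pos_pos)
  ultimately show False by linarith
qed

text \<open>Minimality is tested against changes of a single coefficient, which shift the residual
  by a multiple of \<open>phi T l\<close>. Hence the residual is orthogonal to every
  exponential.\<close>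

lemma least_squares_sol_exact:
  assumes T: "T > 1" and f: "f \<in> L2" and c: "least_squares_sol T f c"
  shows "AE x in Lam1. fourier_op T c x = f x"
proof -
  have cl: "c \<in> sq_integrable ints" using c by (simp add: least_squares_sol_def ell2_eq)
  have f': "f \<in> sq_integrable Lam1" using f by (simp add: L2_eq)
  have T1: "T \<ge> 1" using T by simp
  note F = fourier_op_L2[OF T1]
  define r where "r x = fourier_op T c x - f x" for x
  have r: "r \<in> sq_integrable Lam1" unfolding r_def[abs_def] by (intro sq_integrable_diff F cl f')
  have min: "sq_norm Lam1 r \<le> sq_norm Lam1 (\<lambda>x. fourier_op T d x - f x)" if "d \<in> sq_integrable ints" for d
  proof -
    have "sq_norm Lam1 r = (INF d\<in>sq_integrable ints. sq_norm Lam1 (\<lambda>x. fourier_op T d x - f x))"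
      using c unfolding least_squares_sol_def ell2_eq L2_norm_eq r_def by simp
    also have "\<dots> \<le> sq_norm Lam1 (\<lambda>x. fourier_op T d x - f x)"
      using that by (intro cINF_lower bdd_belowI2[where m = 0] sq_norm_nonneg)
    finally show ?thesis .
  qed
  have "sq_inner Lam1 r (phi T l) = 0" for l
  proof (rule orthogonal_if_minimal[OF r phi_L2])
    fix t
    let ?d = "\<lambda>m. c m + t * (if m = l then 1 else 0)"
    have d: "?d \<in> sq_integrable ints"
      by (rule sq_integrable_add[OF cl sq_integrable_scale[OF indicator_ints]])
    have "AE x in Lam1. fourier_op T ?d x = fourier_op T c x + t * phi T l x"
      by (rule fourier_limit_unique[OF fourier_limit_fourier_op[OF T1 d]
            fourier_limit_add_scale[OF fourier_limit_fourier_op[OF T1 cl] fourier_limit_phi]])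
    then have "AE x in Lam1. fourier_op T ?d x - f x = r x + t * phi T l x"
      by eventually_elim (simp add: r_def)
    then have "sq_norm Lam1 (\<lambda>x. fourier_op T ?d x - f x) = sq_norm Lam1 (\<lambda>x. r x + t * phi T l x)"
      by (intro sq_norm_cong_AE sq_integrable_measurable sq_integrable_diff[OF F[OF d] f']
          sq_integrable_add[OF r sq_integrable_scale[OF phi_L2]])
    with min[OF d] show "sq_norm Lam1 r \<le> sq_norm Lam1 (\<lambda>x. r x + t * phi T l x)" by simp
  qed
  from phi_total[OF T r this] show ?thesis by (simp add: r_def)
qed

subsection \<open>Weights and singular systems\<close>

lemma admissible_weight_pos: "admissible_weight h \<Longrightarrow> 0 < h (of_int \<bar>l\<bar>)"
  by (simp add: admissible_weight_def)

lemma admissible_weight_mono: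
  "admissible_weight h \<Longrightarrow> 0 \<le> x \<Longrightarrow> x \<le> y \<Longrightarrow> h x \<le> h y"
  by (auto simp: admissible_weight_def elim!: mono_onD)

lemma sq_integrable_ints_dominated:
  assumes "d \<in> sq_integrable ints" "\<And>l. cmod (c l) \<le> B * cmod (d l)"
  shows "c \<in> sq_integrable ints"
proof -
  have "integrable ints (\<lambda>l. (cmod (c l))\<^sup>2)"
  proof (rule Bochner_Integration.integrable_bound)
    show "integrable ints (\<lambda>l. B\<^sup>2 * (cmod (d l))\<^sup>2)"
      using assms(1) by (simp add: sq_integrable_integrable)
    show "AE l in ints. norm ((cmod (c l))\<^sup>2) \<le> norm (B\<^sup>2 * (cmod (d l))\<^sup>2)"
      using power_mono[OF assms(2)] by (intro AE_I2) (simp add: power_mult_distrib)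
  qed simp
  then show ?thesis by (simp add: sq_integrable_def)
qed

lemma sq_norm_ints_dominated:
  assumes "d \<in> sq_integrable ints" "\<And>l. cmod (c l) \<le> B * cmod (d l)" "B \<ge> 0"
  shows "sq_norm ints c \<le> B * sq_norm ints d"
proof (rule power2_le_imp_le)
  have c: "c \<in> sq_integrable ints" using assms(1,2) by (rule sq_integrable_ints_dominated)
  have "(sq_norm ints c)\<^sup>2 \<le> (LINT l|ints. B\<^sup>2 * (cmod (d l))\<^sup>2)"
    unfolding sq_norm_power2
    using power_mono[OF assms(2)] assms(1) c
    by (intro integral_mono) (simp_all add: sq_integrable_integrable power_mult_distrib)
  then show "(sq_norm ints c)\<^sup>2 \<le> (B * sq_norm ints d)\<^sup>2"
    by (simp add: power_mult_distrib sq_norm_power2)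
qed (use assms in \<open>simp add: sq_norm_nonneg\<close>)

lemma integral_ints_finite_support:
  fixes g :: "int \<Rightarrow> 'b::{banach, second_countable_topology}"
  assumes "finite L" "\<And>l. l \<notin> L \<Longrightarrow> g l = 0"
  shows "integral\<^sup>L ints g = (\<Sum>l\<in>L. g l)"
proof -
  have sub: "{l. g l \<noteq> 0} \<subseteq> L" using assms(2) by auto
  then have "integral\<^sup>L ints g = (\<Sum>l | g l \<noteq> 0. g l)"
    using assms(1) by (subst lebesgue_integral_count_space_finite_support) (auto intro: finite_subset)
  also have "\<dots> = (\<Sum>l\<in>L. g l)"
    using assms sub by (intro sum.mono_neutral_left) auto
  finally show ?thesis .
qed

text \<open>Coordinates as inner products with unit vectors: this lets Bessel's inequality bound the
  sum of \<open>(cmod (v i l))\<^sup>2\<close> over \<open>i\<close> at a fixed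
  \<open>l\<close>.\<close>

lemma sq_inner_indicator: "sq_inner ints (\<lambda>l. if l = m then 1 else 0) c = cnj (c m)"
  unfolding sq_inner_def
  by (subst integral_ints_finite_support[of "{m}"]) auto

lemma sq_norm_indicator: "sq_norm ints (\<lambda>l. if l = m then 1 else 0) = 1"
proof -
  have "(LINT l|ints. (cmod (if l = m then 1 else 0))\<^sup>2) = 1"
    by (subst integral_ints_finite_support[of "{m}"]) auto
  then show ?thesis by (simp add: sq_norm_def)
qed

lemma
  assumes h: "admissible_weight h"
  shows weight_op_inverse: "weight_op h (\<lambda>l. c l / of_real (h (of_int \<bar>l\<bar>))) = c"
    and inj_weight_op: "inj (weight_op h)"
  using admissible_weight_pos[OF h] by (auto simp: weight_op_def inj_def fun_eq_iff less_le)

lemma weight_inv_weight_op: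
  assumes "admissible_weight h" "c \<in> weight_dom h"
  shows "weight_inv h (weight_op h c) = c"
  unfolding weight_inv_def using inj_weight_op[OF assms(1)] assms(2)
  by (intro inv_into_f_f) (auto intro: inj_on_subset)

text \<open>Serves two purposes: \<open>x = 0\<close> shows that the inverse weight is bounded, and
  a large \<open>x\<close> that it is small on high frequencies.\<close>

lemma divide_weight_le:
  assumes h: "admissible_weight h" and "0 \<le> x" "x \<le> of_int \<bar>l\<bar>"
  shows "cmod (c l / of_real (h (of_int \<bar>l\<bar>))) \<le> 1 / h x * cmod (c l)"
proof -
  have "0 < h x" using h assms(2) by (simp add: admissible_weight_def)
  moreover have "h x \<le> h (of_int \<bar>l\<bar>)" using admissible_weight_mono[OF assms] .
  ultimately have "cmod (c l) / h (of_int \<bar>l\<bar>) \<le> cmod (c l) / h x"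
    by (intro divide_left_mono) auto
  then show ?thesis using admissible_weight_pos[OF h, of l] by (simp add: norm_divide)
qed

lemma divide_weight_ell2:
  assumes h: "admissible_weight h" and c: "c \<in> sq_integrable ints"
  shows "(\<lambda>l. c l / of_real (h (of_int \<bar>l\<bar>))) \<in> sq_integrable ints"
  using c by (rule sq_integrable_ints_dominated) (rule divide_weight_le[OF h, of 0], auto)

lemma weight_inv_eq:
  assumes h: "admissible_weight h" and c: "c \<in> sq_integrable ints"
  shows "weight_inv h c = (\<lambda>l. c l / of_real (h (of_int \<bar>l\<bar>)))"
proof -
  let ?d = "\<lambda>l. c l / of_real (h (of_int \<bar>l\<bar>))"
  note eq = weight_op_inverse[OF h, of c]
  have "?d \<in> weight_dom h"
    unfolding weight_dom_def mem_Collect_eq eq ell2_eq using divide_weight_ell2[OF h c] c by (rule conjI)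
  from weight_inv_weight_op[OF h this] show ?thesis unfolding eq .
qed

lemma weight_inv_ell2:
  assumes "admissible_weight h" "c \<in> sq_integrable ints"
  shows "weight_inv h c \<in> sq_integrable ints"
  using weight_inv_eq[OF assms] divide_weight_ell2[OF assms] by simp

lemma weight_op_weight_inv:
  assumes "admissible_weight h" "c \<in> sq_integrable ints"
  shows "weight_op h (weight_inv h c) = c"
  using weight_inv_eq[OF assms] weight_op_inverse[OF assms(1), of c] by simp

lemma G_op_L2:
  assumes "T \<ge> 1" "admissible_weight h" "c \<in> sq_integrable ints"
  shows "G_op T h c \<in> sq_integrable Lam1"
  unfolding G_op_def using assms by (intro fourier_op_L2 weight_inv_ell2)

lemma G_op_add_scale:
  assumes "T \<ge> 1" and h: "admissible_weight h" and c: "c \<in> sq_integrable ints" and d: "d \<in> sq_integrable ints"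
  shows "AE x in Lam1. G_op T h (\<lambda>l. c l + a * d l) x = G_op T h c x + a * G_op T h d x"
proof -
  have "weight_inv h (\<lambda>l. c l + a * d l) = (\<lambda>l. weight_inv h c l + a * weight_inv h d l)"
    using h c d
    by (simp add: weight_inv_eq sq_integrable_add sq_integrable_scale add_divide_distrib)
  then show ?thesis
    unfolding G_op_def using assms by (simp add: fourier_op_add_scale weight_inv_ell2)
qed

text \<open>Finite linearity is claimed only almost everywhere, because each application of
  \<open>fourier_op\<close> makes its own choice of representative.\<close>

lemma G_op_sum:
  assumes T: "T \<ge> 1" and h: "admissible_weight h" and "finite A"
    and w: "\<And>i. i \<in> A \<Longrightarrow> w i \<in> sq_integrable ints"
  shows "AE x in Lam1. G_op T h (\<lambda>l. \<Sum>i\<in>A. a i * w i l) x = (\<Sum>i\<in>A. a i * G_op T h (w i) x)"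
  using assms(3) w
proof (induction A rule: finite_induct)
  case empty
  \<comment> \<open>Reading 0 as \<open>0 + 1 * 0\<close>, additivity says that the image of 0
    equals twice itself.\<close>
  have "AE x in Lam1. G_op T h (\<lambda>l. 0 + 1 * 0) x = G_op T h (\<lambda>l. 0) x + 1 * G_op T h (\<lambda>l. 0) x"
    using T h by (intro G_op_add_scale sq_integrable_zero)
  then have "AE x in Lam1. G_op T h (\<lambda>l. 0) x = 0" by simp
  then show ?case by simp
next
  case (insert i A)
  have "AE x in Lam1. G_op T h (\<lambda>l. (\<Sum>i\<in>A. a i * w i l) + a i * w i l) x
      = G_op T h (\<lambda>l. \<Sum>i\<in>A. a i * w i l) x + a i * G_op T h (w i) x"
    using insert.prems by (intro G_op_add_scale T h sq_integrable_sum) auto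
  moreover have "AE x in Lam1. G_op T h (\<lambda>l. \<Sum>i\<in>A. a i * w i l) x = (\<Sum>i\<in>A. a i * G_op T h (w i) x)"
    using insert.prems by (intro insert.IH) auto
  ultimately show ?case
    by eventually_elim (simp add: insert.hyps add.commute)
qed

section \<open>Decay of the singular values and spectral truncation\<close>

locale fourier_svd =
  fixes T :: real and h :: "real \<Rightarrow> real" and \<sigma> :: "nat \<Rightarrow> real"
    and v :: "nat \<Rightarrow> int \<Rightarrow> complex" and u :: "nat \<Rightarrow> real \<Rightarrow> complex"
  assumes T: "T > 1" and h: "admissible_weight h" and sys: "singular_system (G_op T h) \<sigma> v u"
begin

lemma T1: "T \<ge> 1" using T by simp

lemma \<sigma>_pos: "i \<ge> 1 \<Longrightarrow> 0 < \<sigma> i"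
  using sys by (simp add: singular_system_def)

lemma \<sigma>_antimono: "i \<ge> 1 \<Longrightarrow> i \<le> j \<Longrightarrow> \<sigma> j \<le> \<sigma> i"
  using sys by (simp add: singular_system_def)

lemma v_ell2: "i \<ge> 1 \<Longrightarrow> v i \<in> sq_integrable ints"
  using sys by (simp add: singular_system_def ell2_eq)

lemma u_L2: "i \<ge> 1 \<Longrightarrow> u i \<in> sq_integrable Lam1"
  using sys by (simp add: singular_system_def L2_eq)

lemma v_orthonormal:
  assumes "i \<ge> 1" "j \<ge> 1"
  shows "sq_inner ints (v i) (v j) = (if i = j then 1 else 0)"
proof -
  have "ell2_inner (v i) (v j) = (if i = j then 1 else 0)"
    using sys assms by (simp add: singular_system_def)
  then show ?thesis using v_ell2 assms by (simp add: ell2_inner_eq ell2_eq)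
qed

lemma u_orthonormal: "i \<ge> 1 \<Longrightarrow> j \<ge> 1 \<Longrightarrow> sq_inner Lam1 (u i) (u j) = (if i = j then 1 else 0)"
  using sys by (simp add: singular_system_def L2_inner_eq)

lemma G_v: "i \<ge> 1 \<Longrightarrow> AE x in Lam1. G_op T h (v i) x = of_real (\<sigma> i) * u i x"
  using sys by (simp add: singular_system_def)

lemma G_expansion:
  assumes "c \<in> sq_integrable ints"
  shows "(\<lambda>n. sq_norm Lam1 (\<lambda>x. (\<Sum>i=1..n. of_real (\<sigma> i) * sq_inner ints c (v i) * u i x) - G_op T h c x))
    \<longlonglongrightarrow> 0"
proof -
  have "(\<lambda>n. L2_norm (\<lambda>x. (\<Sum>i=1..n. of_real (\<sigma> i) * ell2_inner c (v i) * u i x) - G_op T h c x)) \<longlonglongrightarrow> 0"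
    using sys assms by (simp add: singular_system_def ell2_eq)
  moreover have "(\<Sum>i=1..n. of_real (\<sigma> i) * ell2_inner c (v i) * u i x)
      = (\<Sum>i=1..n. of_real (\<sigma> i) * sq_inner ints c (v i) * u i x)" for n x
    using assms v_ell2 by (intro sum.cong refl) (simp add: ell2_inner_eq ell2_eq)
  ultimately show ?thesis by (simp add: L2_norm_eq)
qed

lemma sq_norm_v: "i \<ge> 1 \<Longrightarrow> sq_norm ints (v i) = 1"
  using v_orthonormal[of i i] sq_norm_nonneg[of ints "v i"]
  by (simp add: sq_inner_self power2_eq_1_iff flip: of_real_power)

lemma sq_norm_u: "i \<ge> 1 \<Longrightarrow> sq_norm Lam1 (u i) = 1"
  using u_orthonormal[of i i] sq_norm_nonneg[of Lam1 "u i"]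
  by (simp add: sq_inner_self power2_eq_1_iff flip: of_real_power)

text \<open>\<open>\<sigma> i\<close> is the norm of the image of the unit vector
  \<open>v i\<close>, and the Fourier operator is bounded. Decay of the singular values is thereby
  reduced to the effect of the inverse weight on \<open>v i\<close>.\<close>

lemma \<sigma>_le:
  assumes i: "i \<ge> 1"
  shows "\<sigma> i \<le> sqrt (2 * T) * sq_norm ints (\<lambda>l. v i l / of_real (h (of_int \<bar>l\<bar>)))"
proof -
  have "\<sigma> i = sq_norm Lam1 (\<lambda>x. of_real (\<sigma> i) * u i x)"
    using \<sigma>_pos[OF i] sq_norm_u[OF i] by (simp add: sq_norm_scale)
  also have "\<dots> = sq_norm Lam1 (G_op T h (v i))"
    using G_v[OF i] v_ell2[OF i] u_L2[OF i]
    by (intro sq_norm_cong_AE sq_integrable_measurable G_op_L2 T1 h sq_integrable_scale) (auto elim: AE_mp)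
  also have "\<dots> \<le> sqrt (2 * T) * sq_norm ints (weight_inv h (v i))"
    unfolding G_op_def by (intro fourier_op_bound T1 weight_inv_ell2 h v_ell2 i)
  finally show ?thesis by (simp add: weight_inv_eq[OF h v_ell2[OF i]])
qed

text \<open>Compactness: the high-frequency part of \<open>v i\<close> is damped by the weight, and by Bessel's
  inequality only finitely many \<open>v i\<close> can have a sizeable low-frequency part.\<close>
lemma finite_large_\<sigma>:
  assumes e: "e > 0"
  shows "finite {k. 1 \<le> k \<and> e < \<sigma> k}"
proof (rule ccontr)
  assume inf: "infinite {k. 1 \<le> k \<and> e < \<sigma> k}"
  \<comment> \<open>Singular values do not increase, so infinitely many above \<open>e\<close> force
    all of them above \<open>e\<close>.\<close>
  have large: "e < \<sigma> i" if i: "i \<ge> 1" for i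
  proof -
    from inf obtain k where "k > i" "e < \<sigma> k"
      unfolding infinite_nat_iff_unbounded by blast
    with \<sigma>_antimono[OF i, of k] show ?thesis by simp
  qed
  have h0: "h 0 > 0" using h by (simp add: admissible_weight_def)
  \<comment> \<open>The threshold makes the operator bound times \<open>1 / h x\<close> at most
    \<open>e / 2\<close>, half of the lower bound for the singular values.\<close>
  have "\<forall>\<^sub>F x in at_top. 2 * sqrt (2 * T) / e \<le> h x"
    using h by (simp add: admissible_weight_def filterlim_at_top)
  then obtain N0 where N0: "\<And>x. x \<ge> N0 \<Longrightarrow> 2 * sqrt (2 * T) / e \<le> h x"
    by (auto simp: eventually_at_top_linorder)
  define N where "N = nat \<lceil>N0\<rceil>"
  have hN: "2 * sqrt (2 * T) / e \<le> h (real N)" unfolding N_def by (rule N0) linarith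
  have hNpos: "h (real N) > 0" using h by (simp add: admissible_weight_def)
  define L where "L = {- int N..int N}"
  define B where "B = 2 * T / (h 0)\<^sup>2"
  have B: "B > 0" unfolding B_def using T h0 by simp
  \<comment> \<open>Frequencies outside \<open>L\<close> contribute at most \<open>e / 2\<close> to
    \<open>\<sigma> i\<close>, so those in \<open>L\<close> account for the rest. \<open>B\<close>
    is the square of \<open>sqrt (2 * T) / h 0\<close>, which bounds the inverse weight followed by
    the Fourier operator.\<close>
  have low: "(e / 2)\<^sup>2 \<le> B * (\<Sum>l\<in>L. (cmod (v i l))\<^sup>2)" if i: "i \<ge> 1" for i
  proof -
    define a where "a l = (if l \<in> L then v i l / of_real (h (of_int \<bar>l\<bar>)) else 0)" for l
    define b where "b l = (if l \<in> L then 0 else v i l / of_real (h (of_int \<bar>l\<bar>)))" for l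
    have bl: "cmod (b l) \<le> 1 / h (real N) * cmod (v i l)" for l
    proof (cases "l \<in> L")
      case True
      then show ?thesis using hNpos by (simp add: b_def)
    next
      case False
      then have "real N \<le> of_int \<bar>l\<bar>" unfolding L_def by auto
      from divide_weight_le[OF h _ this, of "v i"] False show ?thesis by (simp add: b_def)
    qed
    have al: "cmod (a l) \<le> 1 / h 0 * cmod (v i l)" for l
      using divide_weight_le[OF h, of 0 l "v i"] h0 by (simp add: a_def)
    note aL = sq_integrable_ints_dominated[OF v_ell2[OF i] al]
    note bL = sq_integrable_ints_dominated[OF v_ell2[OF i] bl]
    have "sq_norm ints b \<le> 1 / h (real N) * sq_norm ints (v i)"
      using hNpos by (intro sq_norm_ints_dominated v_ell2 i bl) simp
    then have "sqrt (2 * T) * sq_norm ints b \<le> sqrt (2 * T) * (1 / h (real N))"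
      using sq_norm_v[OF i] T by (intro mult_left_mono) auto
    also have "\<dots> \<le> e / 2"
      using hN hNpos e by (simp add: field_simps)
    finally have b2: "sqrt (2 * T) * sq_norm ints b \<le> e / 2" .
    have "(\<lambda>l. v i l / of_real (h (of_int \<bar>l\<bar>))) = (\<lambda>l. a l + b l)"
      by (auto simp: a_def b_def)
    then have "\<sigma> i \<le> sqrt (2 * T) * sq_norm ints (\<lambda>l. a l + b l)" using \<sigma>_le[OF i] by simp
    also have "\<dots> \<le> sqrt (2 * T) * (sq_norm ints a + sq_norm ints b)"
      using T by (intro mult_left_mono sq_norm_triangle aL bL) auto
    finally have "e / 2 \<le> sqrt (2 * T) * sq_norm ints a"
      using large[OF i] b2 by (simp add: distrib_left)
    then have "(e / 2)\<^sup>2 \<le> (sqrt (2 * T) * sq_norm ints a)\<^sup>2"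
      using e by (intro power_mono) auto
    also have "\<dots> = 2 * T * (sq_norm ints a)\<^sup>2" using T by (simp add: power_mult_distrib)
    also have "(sq_norm ints a)\<^sup>2 = (\<Sum>l\<in>L. (cmod (a l))\<^sup>2)"
      unfolding sq_norm_power2 by (rule integral_ints_finite_support) (auto simp: L_def a_def)
    also have "\<dots> \<le> (\<Sum>l\<in>L. (1 / h 0 * cmod (v i l))\<^sup>2)"
      by (intro sum_mono power_mono al) auto
    also have "\<dots> = (\<Sum>l\<in>L. (cmod (v i l))\<^sup>2) / (h 0)\<^sup>2"
      by (simp add: power_divide sum_divide_distrib)
    finally show ?thesis using T by (simp add: B_def)
  qed
  have bessel: "(\<Sum>i=1..n. (cmod (v i l))\<^sup>2) \<le> 1" for n l
    using Bessel_inequality[of "{1..n}" v ints "\<lambda>m. if m = l then 1 else 0"] v_ell2 v_orthonormal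
    by (simp add: sq_inner_indicator sq_norm_indicator indicator_ints)
  \<comment> \<open>Summed over \<open>i\<close>, the lower bounds grow with \<open>n\<close>, while
    each of the finitely many coordinates in \<open>L\<close> contributes a bounded total.\<close>
  have bound: "real n * (e / 2)\<^sup>2 \<le> B * real (card L)" for n
  proof -
    have "real n * (e / 2)\<^sup>2 = (\<Sum>i=1..n. (e / 2)\<^sup>2)" by simp
    also have "\<dots> \<le> (\<Sum>i=1..n. B * (\<Sum>l\<in>L. (cmod (v i l))\<^sup>2))" by (intro sum_mono low) auto
    also have "\<dots> = B * (\<Sum>l\<in>L. \<Sum>i=1..n. (cmod (v i l))\<^sup>2)"
      by (simp add: sum_distrib_left[symmetric] sum.swap[of _ L])
    also have "\<dots> \<le> B * (\<Sum>l\<in>L. 1)" using B by (intro mult_left_mono sum_mono bessel) auto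
    finally show ?thesis by simp
  qed
  obtain n where "B * real (card L) / (e / 2)\<^sup>2 < real n" using reals_Archimedean2 by blast
  with bound[of n] e show False by (simp add: field_simps)
qed

text \<open>The supremum is a maximum because the set is finite, by the decay of the singular
  values, and nonempty, by \<open>e < \<sigma> 1\<close>. Monotonicity makes the set an initial
  segment.\<close>

lemma trunc_index:
  assumes "0 < e" "e < \<sigma> 1"
  shows "i \<ge> 1 \<Longrightarrow> i \<le> trunc_index \<sigma> e \<Longrightarrow> e < \<sigma> i"
    and "i > trunc_index \<sigma> e \<Longrightarrow> \<sigma> i \<le> e"
proof -
  let ?S = "{k. 1 \<le> k \<and> e < \<sigma> k}"
  have fin: "finite ?S" using assms(1) by (rule finite_large_\<sigma>)
  have ne: "?S \<noteq> {}" using assms(2) by auto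
  have eq: "trunc_index \<sigma> e = Max ?S"
    unfolding trunc_index_def using fin ne by (rule cSup_eq_Max)
  have mem: "trunc_index \<sigma> e \<in> ?S" unfolding eq using fin ne by (rule Max_in)
  show "e < \<sigma> i" if "i \<ge> 1" "i \<le> trunc_index \<sigma> e"
    using mem \<sigma>_antimono[OF that] by simp
  show "\<sigma> i \<le> e" if i: "i > trunc_index \<sigma> e"
  proof (rule ccontr)
    assume "\<not> \<sigma> i \<le> e"
    then have "i \<in> ?S" using i by auto
    from Max_ge[OF fin this] i eq show False by simp
  qed
qed

lemma expansion_L2: "(\<lambda>x. \<Sum>i=1..n. a i * u i x) \<in> sq_integrable Lam1"
  by (intro sq_integrable_sum u_L2) auto

lemma inner_u_expansion:
  assumes "i \<ge> 1" "n \<ge> i"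
  shows "sq_inner Lam1 (\<lambda>x. \<Sum>j=1..n. a j * u j x) (u i) = a i"
proof -
  have "sq_inner Lam1 (\<lambda>x. \<Sum>j=1..n. a j * u j x) (u i) = (\<Sum>j=1..n. a j * sq_inner Lam1 (u j) (u i))"
    using assms by (intro sq_inner_sum_left u_L2) auto
  also have "\<dots> = (\<Sum>j=1..n. if j = i then a j else 0)"
    using assms by (intro sum.cong refl) (simp add: u_orthonormal)
  finally show ?thesis using assms by simp
qed

lemma trunc_op_ell2: "trunc_op \<sigma> v u k g \<in> sq_integrable ints"
  unfolding trunc_op_def by (intro sq_integrable_sum v_ell2) auto

text \<open>Division by \<open>\<sigma> i\<close> and application of the operator cancel, which
  leaves the orthogonal projection onto the first \<open>k\<close> vectors
  \<open>u i\<close>.\<close>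

lemma G_trunc_op:
  "AE t in Lam1. G_op T h (trunc_op \<sigma> v u k g) t = (\<Sum>i=1..k. sq_inner Lam1 g (u i) * u i t)"
proof -
  let ?a = "\<lambda>i. of_real (1 / \<sigma> i) * sq_inner Lam1 g (u i)"
  have "AE t in Lam1. G_op T h (trunc_op \<sigma> v u k g) t = (\<Sum>i=1..k. ?a i * G_op T h (v i) t)"
    unfolding trunc_op_def L2_inner_eq by (intro G_op_sum T1 h v_ell2) auto
  moreover have "AE t in Lam1. \<forall>i\<in>{1..k}. G_op T h (v i) t = of_real (\<sigma> i) * u i t"
    by (intro AE_finite_allI) (auto simp: G_v)
  ultimately show ?thesis
  proof eventually_elim
    case (elim t)
    have "?a i * G_op T h (v i) t = sq_inner Lam1 g (u i) * u i t" if "i \<in> {1..k}" for i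
      using elim(2) that \<sigma>_pos[of i] by simp
    then show ?case using elim(1) by simp
  qed
qed

section \<open>Error bounds for truncation when the exact data lie in the range\<close>

context
  fixes f x
  assumes f: "f \<in> sq_integrable Lam1" and x: "x \<in> sq_integrable ints"
    and Gx: "AE t in Lam1. G_op T h x t = f t"
begin

lemma expansion_tendsto:
  "(\<lambda>n. sq_norm Lam1 (\<lambda>t. (\<Sum>i=1..n. of_real (\<sigma> i) * sq_inner ints x (v i) * u i t) - f t)) \<longlonglongrightarrow> 0"
proof -
  have "sq_norm Lam1 (\<lambda>t. (\<Sum>i=1..n. of_real (\<sigma> i) * sq_inner ints x (v i) * u i t) - f t)
      = sq_norm Lam1 (\<lambda>t. (\<Sum>i=1..n. of_real (\<sigma> i) * sq_inner ints x (v i) * u i t) - G_op T h x t)" for n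
  proof (rule sq_norm_cong_AE)
    show "AE t in Lam1. (\<Sum>i=1..n. of_real (\<sigma> i) * sq_inner ints x (v i) * u i t) - f t
        = (\<Sum>i=1..n. of_real (\<sigma> i) * sq_inner ints x (v i) * u i t) - G_op T h x t"
      using Gx by eventually_elim simp
  qed (intro sq_integrable_measurable sq_integrable_diff expansion_L2 f G_op_L2 T1 h x)+
  then show ?thesis using G_expansion[OF x] by simp
qed

text \<open>The coefficient of \<open>u i\<close> in the partial sums is constant from
  \<open>n = i\<close> on, and the inner product with the unit vector \<open>u i\<close> is
  continuous in norm.\<close>

lemma inner_f_u:
  assumes i: "i \<ge> 1"
  shows "sq_inner Lam1 f (u i) = of_real (\<sigma> i) * sq_inner ints x (v i)"
proof -
  let ?a = "\<lambda>i. of_real (\<sigma> i) * sq_inner ints x (v i)"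
  have "\<forall>\<^sub>F n in sequentially. cmod (?a i - sq_inner Lam1 f (u i))
      \<le> sq_norm Lam1 (\<lambda>t. (\<Sum>i=1..n. ?a i * u i t) - f t)"
    using eventually_ge_at_top[of i]
  proof eventually_elim
    case (elim n)
    have "?a i - sq_inner Lam1 f (u i) = sq_inner Lam1 (\<lambda>t. (\<Sum>i=1..n. ?a i * u i t) - f t) (u i)"
      using inner_u_expansion[OF i elim, of ?a]
      by (subst sq_inner_diff_left[OF expansion_L2 f u_L2[OF i]]) simp
    then show ?case
      using sq_inner_bound[OF sq_integrable_diff[OF expansion_L2 f] u_L2[OF i], of ?a n]
      by (simp add: sq_norm_u[OF i])
  qed
  then have "cmod (?a i - sq_inner Lam1 f (u i)) \<le> 0"
    by (intro tendsto_lowerbound[OF expansion_tendsto]) auto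
  then show ?thesis by simp
qed

text \<open>The difference of two partial sums is an orthogonal sum. Each factor
  \<open>\<sigma> i\<close> in it is at most \<open>e\<close>, and Bessel's inequality for the
  \<open>v i\<close> bounds the rest uniformly in \<open>n\<close>, so the estimate survives the
  limit in \<open>n\<close>.\<close>

lemma expansion_tail:
  assumes e: "e \<ge> 0" and tail: "\<And>i. i > k \<Longrightarrow> \<sigma> i \<le> e"
  shows "sq_norm Lam1 (\<lambda>t. (\<Sum>i=1..k. sq_inner Lam1 f (u i) * u i t) - f t) \<le> e * sq_norm ints x"
proof -
  let ?a = "\<lambda>i. of_real (\<sigma> i) * sq_inner ints x (v i)"
  let ?s = "\<lambda>n t. \<Sum>i=1..n. ?a i * u i t"
  have diff: "sq_norm Lam1 (\<lambda>t. ?s k t - ?s n t) \<le> e * sq_norm ints x" if "n \<ge> k" for n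
  proof (rule power2_le_imp_le)
    have eq: "?s n t - ?s k t = (\<Sum>i=k+1..n. ?a i * u i t)" for t
      using sum.ub_add_nat[of 1 k "\<lambda>i. ?a i * u i t" "n - k"] that by simp
    have "(sq_norm Lam1 (\<lambda>t. ?s k t - ?s n t))\<^sup>2 = (sq_norm Lam1 (\<lambda>t. \<Sum>i=k+1..n. ?a i * u i t))\<^sup>2"
      unfolding sq_norm_minus_commute[of Lam1 "?s k"] eq ..
    also have "\<dots> = (\<Sum>i=k+1..n. (cmod (?a i))\<^sup>2 * 1)"
      by (intro sq_norm_orthogonal_sum) (auto simp: u_L2 u_orthonormal)
    also have "\<dots> \<le> (\<Sum>i=k+1..n. e\<^sup>2 * (cmod (sq_inner ints x (v i)))\<^sup>2)"
    proof (rule sum_mono)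
      fix i assume i: "i \<in> {k+1..n}"
      have "(\<sigma> i)\<^sup>2 \<le> e\<^sup>2" using i tail[of i] \<sigma>_pos[of i] by (intro power_mono) auto
      then show "(cmod (?a i))\<^sup>2 * 1 \<le> e\<^sup>2 * (cmod (sq_inner ints x (v i)))\<^sup>2"
        by (simp add: norm_mult power_mult_distrib mult_right_mono)
    qed
    also have "\<dots> = e\<^sup>2 * (\<Sum>i=k+1..n. (cmod (sq_inner ints x (v i)))\<^sup>2)" by (simp add: sum_distrib_left)
    also have "\<dots> \<le> e\<^sup>2 * (sq_norm ints x)\<^sup>2"
      by (intro mult_left_mono Bessel_inequality x) (auto simp: v_ell2 v_orthonormal)
    finally show "(sq_norm Lam1 (\<lambda>t. ?s k t - ?s n t))\<^sup>2 \<le> (e * sq_norm ints x)\<^sup>2"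
      by (simp add: power_mult_distrib)
  qed (use e in \<open>simp add: sq_norm_nonneg\<close>)
  have "\<forall>\<^sub>F n in sequentially. sq_norm Lam1 (\<lambda>t. ?s k t - f t)
      \<le> e * sq_norm ints x + sq_norm Lam1 (\<lambda>t. ?s n t - f t)"
    using eventually_ge_at_top[of k]
  proof eventually_elim
    case (elim n)
    have "sq_norm Lam1 (\<lambda>t. ?s k t - f t)
        \<le> sq_norm Lam1 (\<lambda>t. ?s k t - ?s n t) + sq_norm Lam1 (\<lambda>t. ?s n t - f t)"
      by (intro sq_norm_triangle_diff expansion_L2 f)
    with diff[OF elim] show ?case by linarith
  qed
  then have "sq_norm Lam1 (\<lambda>t. ?s k t - f t) \<le> e * sq_norm ints x + 0"
    by (intro tendsto_lowerbound[OF tendsto_add[OF tendsto_const expansion_tendsto]]) auto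
  moreover have "(\<Sum>i=1..k. sq_inner Lam1 f (u i) * u i t) = ?s k t" for t
    by (intro sum.cong refl) (simp add: inner_f_u)
  ultimately show ?thesis by simp
qed

text \<open>A projection does not enlarge the noise, so only the upper bound on the discarded
  singular values enters.\<close>

lemma residual_bound:
  assumes e: "e \<ge> 0" and tail: "\<And>i. i > k \<Longrightarrow> \<sigma> i \<le> e" and g: "g \<in> sq_integrable Lam1"
  shows "sq_norm Lam1 (\<lambda>t. G_op T h (trunc_op \<sigma> v u k g) t - f t)
    \<le> sq_norm Lam1 (\<lambda>t. g t - f t) + e * sq_norm ints x"
proof -
  let ?P = "\<lambda>g t. \<Sum>i=1..k. sq_inner Lam1 g (u i) * u i t"
  let ?d = "\<lambda>t. g t - f t"
  have d: "?d \<in> sq_integrable Lam1" using g f by (rule sq_integrable_diff)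
  have "sq_norm Lam1 (\<lambda>t. G_op T h (trunc_op \<sigma> v u k g) t - f t) = sq_norm Lam1 (\<lambda>t. ?P g t - f t)"
  proof (rule sq_norm_cong_AE)
    show "AE t in Lam1. G_op T h (trunc_op \<sigma> v u k g) t - f t = ?P g t - f t"
      using G_trunc_op by eventually_elim simp
  qed (intro sq_integrable_measurable sq_integrable_diff expansion_L2 f G_op_L2 T1 h trunc_op_ell2)+
  moreover have "sq_norm Lam1 (\<lambda>t. ?P g t - f t) \<le> sq_norm Lam1 (?P ?d) + sq_norm Lam1 (\<lambda>t. ?P f t - f t)"
  proof -
    have "(\<lambda>t. ?P g t - ?P f t) = ?P ?d"
      unfolding sum_subtractf[symmetric]
      by (intro ext sum.cong refl) (simp add: sq_inner_diff_left g f u_L2 left_diff_distrib)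
    moreover have "sq_norm Lam1 (\<lambda>t. ?P g t - f t)
        \<le> sq_norm Lam1 (\<lambda>t. ?P g t - ?P f t) + sq_norm Lam1 (\<lambda>t. ?P f t - f t)"
      by (intro sq_norm_triangle_diff expansion_L2 f)
    ultimately show ?thesis by (simp only:)
  qed
  moreover have "sq_norm Lam1 (?P ?d) \<le> sq_norm Lam1 ?d"
  proof (rule power2_le_imp_le)
    have "(sq_norm Lam1 (?P ?d))\<^sup>2 = (\<Sum>i=1..k. (cmod (sq_inner Lam1 ?d (u i)))\<^sup>2 * 1)"
      by (intro sq_norm_orthogonal_sum) (auto simp: u_L2 u_orthonormal)
    also have "\<dots> \<le> (sq_norm Lam1 ?d)\<^sup>2"
      unfolding mult_1_right by (intro Bessel_inequality d) (auto simp: u_L2 u_orthonormal)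
    finally show "(sq_norm Lam1 (?P ?d))\<^sup>2 \<le> (sq_norm Lam1 ?d)\<^sup>2" .
  qed (rule sq_norm_nonneg)
  moreover have "sq_norm Lam1 (\<lambda>t. ?P f t - f t) \<le> e * sq_norm ints x"
    using e tail by (rule expansion_tail)
  ultimately show ?thesis by linarith
qed

text \<open>Here only the lower bound on the retained singular values enters: it limits the
  amplification of the noise. The discarded part of \<open>x\<close> is bounded by the norm of
  \<open>x\<close>.\<close>

lemma coefficient_bound:
  assumes e: "e > 0" and large: "\<And>i. i \<ge> 1 \<Longrightarrow> i \<le> k \<Longrightarrow> e < \<sigma> i" and g: "g \<in> sq_integrable Lam1"
  shows "sq_norm ints (\<lambda>l. trunc_op \<sigma> v u k g l - x l)
    \<le> sq_norm Lam1 (\<lambda>t. g t - f t) / e + sq_norm ints x"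
proof -
  let ?d = "\<lambda>t. g t - f t"
  let ?c = "\<lambda>i. of_real (1 / \<sigma> i) * sq_inner Lam1 ?d (u i)"
  let ?N = "\<lambda>l. \<Sum>i=1..k. ?c i * v i l"
  let ?Q = "\<lambda>l. \<Sum>i=1..k. sq_inner ints x (v i) * v i l"
  have d: "?d \<in> sq_integrable Lam1" using g f by (rule sq_integrable_diff)
  have N: "?N \<in> sq_integrable ints" and Q: "?Q \<in> sq_integrable ints"
    by (intro sq_integrable_sum v_ell2; simp)+
  have eq: "trunc_op \<sigma> v u k g l = ?N l + ?Q l" for l
    unfolding trunc_op_def L2_inner_eq sum.distrib[symmetric]
  proof (rule sum.cong[OF refl])
    fix i assume "i \<in> {1..k}"
    then have i: "i \<ge> 1" by simp
    \<comment> \<open>On the exact part of the data, division by \<open>\<sigma> i\<close> returns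
      the coefficient of \<open>x\<close>.\<close>
    have split: "sq_inner Lam1 g (u i) = sq_inner Lam1 ?d (u i) + of_real (\<sigma> i) * sq_inner ints x (v i)"
      using inner_f_u[OF i] by (simp add: sq_inner_diff_left g f u_L2[OF i])
    have one: "complex_of_real (1 / \<sigma> i) * of_real (\<sigma> i) = 1"
      using \<sigma>_pos[OF i] by (subst of_real_mult[symmetric]) simp
    have "of_real (1 / \<sigma> i) * sq_inner Lam1 g (u i) * v i l
        = ?c i * v i l + of_real (1 / \<sigma> i) * of_real (\<sigma> i) * (sq_inner ints x (v i) * v i l)"
      unfolding split by (simp only: distrib_left distrib_right mult.assoc)
    then show "of_real (1 / \<sigma> i) * sq_inner Lam1 g (u i) * v i l = ?c i * v i l + sq_inner ints x (v i) * v i l"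
      unfolding one by (simp only: mult_1_left)
  qed
  have "sq_norm ints (\<lambda>l. trunc_op \<sigma> v u k g l - x l) = sq_norm ints (\<lambda>l. ?N l + (?Q l - x l))"
    unfolding eq add_diff_eq ..
  moreover have "sq_norm ints (\<lambda>l. ?N l + (?Q l - x l)) \<le> sq_norm ints ?N + sq_norm ints (\<lambda>l. ?Q l - x l)"
    by (intro sq_norm_triangle sq_integrable_diff N Q x)
  moreover have "sq_norm ints (\<lambda>l. ?Q l - x l) \<le> sq_norm ints x"
    unfolding sq_norm_minus_commute[of ints ?Q]
    by (intro sq_norm_projection_error_le x) (auto simp: v_ell2 v_orthonormal)
  moreover have "sq_norm ints ?N \<le> sq_norm Lam1 ?d / e"
  proof (rule power2_le_imp_le)
    have "(sq_norm ints ?N)\<^sup>2 = (\<Sum>i=1..k. (cmod (?c i))\<^sup>2 * 1)"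
      by (intro sq_norm_orthogonal_sum) (auto simp: v_ell2 v_orthonormal)
    also have "\<dots> \<le> (\<Sum>i=1..k. (1 / e)\<^sup>2 * (cmod (sq_inner Lam1 ?d (u i)))\<^sup>2)"
    proof (rule sum_mono)
      fix i assume i: "i \<in> {1..k}"
      then have "0 < \<sigma> i" "1 / \<sigma> i \<le> 1 / e"
        using large[of i] \<sigma>_pos[of i] e by (auto intro!: divide_left_mono)
      then have "(1 / \<sigma> i)\<^sup>2 \<le> (1 / e)\<^sup>2" by (intro power_mono) auto
      then have "(1 / \<sigma> i)\<^sup>2 * (cmod (sq_inner Lam1 ?d (u i)))\<^sup>2 \<le> (1 / e)\<^sup>2 * (cmod (sq_inner Lam1 ?d (u i)))\<^sup>2"
        by (rule mult_right_mono) simp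
      then show "(cmod (?c i))\<^sup>2 * 1 \<le> (1 / e)\<^sup>2 * (cmod (sq_inner Lam1 ?d (u i)))\<^sup>2"
        by (simp only: norm_mult norm_of_real power_mult_distrib power2_abs mult_1_right)
    qed
    also have "\<dots> = (1 / e)\<^sup>2 * (\<Sum>i=1..k. (cmod (sq_inner Lam1 ?d (u i)))\<^sup>2)"
      by (simp add: sum_distrib_left)
    also have "\<dots> \<le> (1 / e)\<^sup>2 * (sq_norm Lam1 ?d)\<^sup>2"
      by (intro mult_left_mono Bessel_inequality d) (auto simp: u_L2 u_orthonormal)
    finally show "(sq_norm ints ?N)\<^sup>2 \<le> (sq_norm Lam1 ?d / e)\<^sup>2"
      by (simp add: power_divide)
  qed (use e in \<open>simp add: sq_norm_nonneg\<close>)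
  ultimately show ?thesis by linarith
qed

end

end

section \<open>The convergence estimate\<close>

text \<open>\<open>sqrt 2\<close> is the square root of the length of the interval.\<close>

lemma sq_norm_le_uniform:
  assumes "d \<in> sq_integrable Lam1" "\<And>t. t \<in> {-1..1} \<Longrightarrow> cmod (d t) \<le> e" "e \<ge> 0"
  shows "sq_norm Lam1 d \<le> sqrt 2 * e"
proof (rule power2_le_imp_le)
  have "(LINT t|Lam1. (cmod (d t))\<^sup>2) \<le> (LINT t|Lam1. e\<^sup>2)"
  proof (rule integral_mono)
    show "integrable Lam1 (\<lambda>t. (cmod (d t))\<^sup>2)" using assms(1) by (rule sq_integrable_integrable)
    show "integrable Lam1 (\<lambda>t. e\<^sup>2)" by (intro continuous_imp_integrable_real continuous_intros)
  qed (use assms(2) in \<open>auto intro: power_mono\<close>)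
  then show "(sq_norm Lam1 d)\<^sup>2 \<le> (sqrt 2 * e)\<^sup>2"
    by (simp add: sq_norm_power2 measure_restrict_space power_mult_distrib)
qed (use assms in simp)

text \<open>The argument gives the estimates on all of \<open>{0<..<\<sigma> 1}\<close>, with one
  constant that depends neither on \<epsilon> nor on the perturbed data.\<close>

theorem theorem1:
  fixes T E C\<^sub>0 :: real
    and f :: "real \<Rightarrow> complex"
    and h\<^sub>s h\<^sub>r :: "real \<Rightarrow> real"
    and \<sigma> :: "nat \<Rightarrow> real"
    and v :: "nat \<Rightarrow> int \<Rightarrow> complex"
    and u :: "nat \<Rightarrow> real \<Rightarrow> complex"
    and cdag :: "int \<Rightarrow> complex"
  assumes "T > 1"
    and "f \<in> L2"
    and "admissible_weight h\<^sub>s"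
    and "admissible_weight h\<^sub>r"
    and "singular_system (G_op T h\<^sub>r) \<sigma> v u"
    and "weighted_best_approx_sol T h\<^sub>s f cdag"
    and "E > 0"
    and "ell2_norm (weight_op h\<^sub>s cdag) \<le> E"
    and "(SUP l::int. ereal (h\<^sub>r (of_int \<bar>l\<bar>) / h\<^sub>s (of_int \<bar>l\<bar>))) \<le> ereal C\<^sub>0"
  shows "\<exists>C. \<forall>\<^sub>F \<epsilon> in at 0 within {0<..<\<sigma> 1}.
           \<forall>g\<in>L2. (\<forall>x\<in>{-1..1}. cmod (g x - f x) \<le> \<epsilon>) \<longrightarrow>
             L2_norm (\<lambda>x. fourier_op T (regularized_sol h\<^sub>r \<sigma> v u \<epsilon> g) x - f x) \<le> C * \<epsilon> \<and>
             (\<lambda>l. regularized_sol h\<^sub>r \<sigma> v u \<epsilon> g l - cdag l) \<in> weight_dom h\<^sub>r \<and>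
             ell2_norm (weight_op h\<^sub>r (\<lambda>l. regularized_sol h\<^sub>r \<sigma> v u \<epsilon> g l - cdag l)) \<le> C"
proof -
  interpret fourier_svd T h\<^sub>r \<sigma> v u using assms by unfold_locales
  have f: "f \<in> sq_integrable Lam1" using assms(2) by (simp add: L2_eq)
  have cdag: "least_squares_sol T f cdag" "cdag \<in> sq_integrable ints" "weight_op h\<^sub>s cdag \<in> sq_integrable ints"
    using assms(6) by (auto simp: weighted_best_approx_sol_def weight_dom_def ell2_eq)
  have ratio: "h\<^sub>r (of_int \<bar>l\<bar>) \<le> C\<^sub>0 * h\<^sub>s (of_int \<bar>l\<bar>)" for l
  proof -
    have "ereal (h\<^sub>r (of_int \<bar>l\<bar>) / h\<^sub>s (of_int \<bar>l\<bar>)) \<le> ereal C\<^sub>0"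
      by (rule order_trans[OF SUP_upper assms(9)]) simp
    then show ?thesis
      using admissible_weight_pos[OF assms(3), of l] by (simp add: pos_divide_le_eq)
  qed
  \<comment> \<open>Index 0 suffices, as \<open>C\<^sub>0\<close> bounds a quotient of positive
    weights.\<close>
  have C0: "C\<^sub>0 \<ge> 0"
  proof (rule ccontr)
    assume "\<not> C\<^sub>0 \<ge> 0"
    then have "C\<^sub>0 * h\<^sub>s (of_int \<bar>0\<bar>) \<le> 0"
      using admissible_weight_pos[OF assms(3), of 0] by (simp add: mult_le_0_iff)
    with ratio[of 0] admissible_weight_pos[OF assms(4), of 0] show False by linarith
  qed
  \<comment> \<open>The comparison of the weights transfers the bound by \<open>E\<close> from
    \<open>h\<^sub>s\<close> to \<open>h\<^sub>r\<close> and puts \<open>cdag\<close> into the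
    domain of the latter.\<close>
  define x where "x = weight_op h\<^sub>r cdag"
  have dom: "cmod (x l) \<le> C\<^sub>0 * cmod (weight_op h\<^sub>s cdag l)" for l
    using mult_right_mono[OF ratio[of l] norm_ge_zero[of "cdag l"]]
      admissible_weight_pos[OF assms(3), of l] admissible_weight_pos[OF assms(4), of l]
    by (simp add: x_def weight_op_def norm_mult mult.assoc)
  have x: "x \<in> sq_integrable ints" using cdag(3) dom by (rule sq_integrable_ints_dominated)
  have "sq_norm ints x \<le> C\<^sub>0 * sq_norm ints (weight_op h\<^sub>s cdag)"
    using cdag(3) dom C0 by (rule sq_norm_ints_dominated)
  also have "\<dots> \<le> C\<^sub>0 * E"
    using assms(8) cdag(3) C0 by (intro mult_left_mono) (simp_all add: ell2_norm_eq ell2_eq)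
  finally have xE: "sq_norm ints x \<le> C\<^sub>0 * E" .
  have "weight_inv h\<^sub>r x = cdag"
    unfolding x_def using cdag(2) x
    by (intro weight_inv_weight_op assms) (simp add: weight_dom_def ell2_eq x_def)
  then have Gx: "AE t in Lam1. G_op T h\<^sub>r x t = f t"
    using least_squares_sol_exact[OF assms(1,2) cdag(1)] by (simp add: G_op_def)
  \<comment> \<open>\<open>sqrt 2\<close> comes from the noise and \<open>C\<^sub>0 * E\<close> from
    the norm of \<open>x\<close>; the same sum serves both estimates.\<close>
  define C where "C = sqrt 2 + C\<^sub>0 * E"
  have main: "L2_norm (\<lambda>x. fourier_op T (regularized_sol h\<^sub>r \<sigma> v u \<epsilon> g) x - f x) \<le> C * \<epsilon> \<and>
      (\<lambda>l. regularized_sol h\<^sub>r \<sigma> v u \<epsilon> g l - cdag l) \<in> weight_dom h\<^sub>r \<and>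
      ell2_norm (weight_op h\<^sub>r (\<lambda>l. regularized_sol h\<^sub>r \<sigma> v u \<epsilon> g l - cdag l)) \<le> C"
    if \<epsilon>: "0 < \<epsilon>" "\<epsilon> < \<sigma> 1" and g: "g \<in> L2" "\<forall>x\<in>{-1..1}. cmod (g x - f x) \<le> \<epsilon>" for \<epsilon> g
  proof -
    have g': "g \<in> sq_integrable Lam1" using g(1) by (simp add: L2_eq)
    let ?k = "trunc_index \<sigma> \<epsilon>"
    let ?y = "trunc_op \<sigma> v u ?k g"
    let ?c = "regularized_sol h\<^sub>r \<sigma> v u \<epsilon> g"
    have noise: "sq_norm Lam1 (\<lambda>t. g t - f t) \<le> sqrt 2 * \<epsilon>"
      using \<epsilon> g(2) by (intro sq_norm_le_uniform sq_integrable_diff g' f) auto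
    have y: "?y \<in> sq_integrable ints" by (rule trunc_op_ell2)
    have "sq_norm Lam1 (\<lambda>t. G_op T h\<^sub>r ?y t - f t)
        \<le> sq_norm Lam1 (\<lambda>t. g t - f t) + \<epsilon> * sq_norm ints x"
      by (rule residual_bound[OF f x Gx less_imp_le[OF \<epsilon>(1)] trunc_index(2)[OF \<epsilon>] g'])
    also have "\<dots> \<le> sqrt 2 * \<epsilon> + \<epsilon> * (C\<^sub>0 * E)"
      using \<epsilon> by (intro add_mono noise mult_left_mono xE) auto
    also have "\<dots> = C * \<epsilon>" by (simp add: C_def algebra_simps)
    finally have 1: "L2_norm (\<lambda>t. fourier_op T ?c t - f t) \<le> C * \<epsilon>"
      by (simp only: L2_norm_eq G_op_def regularized_sol_def)
    have c: "?c \<in> sq_integrable ints"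
      unfolding regularized_sol_def by (intro weight_inv_ell2 assms y)
    have "weight_op h\<^sub>r ?c = ?y"
      unfolding regularized_sol_def by (intro weight_op_weight_inv assms y)
    \<comment> \<open>Weighting undoes \<open>weight_inv\<close>, so the error to be measured is
      that of the truncated expansion against \<open>x\<close>.\<close>
    then have op: "weight_op h\<^sub>r (\<lambda>l. ?c l - cdag l) = (\<lambda>l. ?y l - x l)"
      by (simp add: weight_op_def x_def fun_eq_iff right_diff_distrib)
    have yx: "(\<lambda>l. ?y l - x l) \<in> sq_integrable ints" by (intro sq_integrable_diff y x)
    have 2: "(\<lambda>l. ?c l - cdag l) \<in> weight_dom h\<^sub>r"
      using sq_integrable_diff[OF c cdag(2)] yx by (simp add: weight_dom_def op ell2_eq)
    have "sq_norm ints (\<lambda>l. ?y l - x l) \<le> sq_norm Lam1 (\<lambda>t. g t - f t) / \<epsilon> + sq_norm ints x"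
      by (rule coefficient_bound[OF f x Gx \<epsilon>(1) trunc_index(1)[OF \<epsilon>] g'])
    also have "\<dots> \<le> sqrt 2 + C\<^sub>0 * E"
      using noise \<epsilon> by (intro add_mono xE) (simp add: pos_divide_le_eq)
    finally have 3: "ell2_norm (weight_op h\<^sub>r (\<lambda>l. ?c l - cdag l)) \<le> C"
      using yx by (simp add: op ell2_norm_eq ell2_eq C_def)
    from 1 2 3 show ?thesis by (intro conjI)
  qed
  show ?thesis
    unfolding eventually_at_filter
    by (intro exI[of _ C] always_eventually allI impI ballI main) simp_all
qed

end
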